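(* Let $\tau$ vary in the upper half plane, set $\omega_1=1/2$, $\omega_3=\tau/2$, $\omega_2=-\omega_1-\omega_3$, let $e_i=\wp(\omega_i)$ $(i=1,2,3)$ and $\eta_1=\zeta(\omega_1)$ be formed from the Weierstrass functions with periods $(2\omega_1,2\omega_3)=(1,\tau)$, and set $g_2=-4(e_1e_2+e_2e_3+e_3e_1)$. Then, as functions of $\tau$, $$\frac{d\eta_1}{d\tau}=\frac{-\eta_1^2+g_2/48}{\pi\sqrt{-1}}.$$
   Context: For $\tau$ in the upper half plane, $\wp$ and $\zeta$ denote the Weierstrass $\wp$-function and Weierstrass zeta function of the lattice $\mathbb{Z}\oplus\tau\mathbb{Z}$ (with $\zeta'=-\wp$, $\zeta$ odd). Thus $e_1=\wp(1/2)$, $e_2=\wp((1+\tau)/2)$, $e_3=\wp(\tau/2)$ and $\eta_1=\zeta(1/2)$, all regarded as holomorphic functions of $\tau$. *)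

theory Defs
  imports "HOL-Analysis.Analysis"
begin

definition period_lattice :: "complex \<Rightarrow> complex \<Rightarrow> complex set" where
  "period_lattice a b = {of_int m * a + of_int n * b | m n :: int. True}"

(* For a lattice L both series below converge absolutely off L, so the unconditional infsum is
   the usual value. They are meant for z outside L; at lattice points (the poles) the value is
   an irrelevant artefact of totality. *)
definition weierstrass_p :: "complex set \<Rightarrow> complex \<Rightarrow> complex" where
  "weierstrass_p L z = 1 / z\<^sup>2 + (\<Sum>\<^sub>\<infinity>w\<in>L - {0}. 1 / (z - w)\<^sup>2 - 1 / w\<^sup>2)"

(* The odd function with derivative - weierstrass_p L. *)
definition weierstrass_zeta :: "complex set \<Rightarrow> complex \<Rightarrow> complex" where
  "weierstrass_zeta L z = 1 / z + (\<Sum>\<^sub>\<infinity>w\<in>L - {0}. 1 / (z - w) + 1 / w + z / w\<^sup>2)"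

definition omega1 :: "complex \<Rightarrow> complex" where
  "omega1 \<tau> = 1 / 2"

definition omega3 :: "complex \<Rightarrow> complex" where
  "omega3 \<tau> = \<tau> / 2"

definition omega2 :: "complex \<Rightarrow> complex" where
  "omega2 \<tau> = - omega1 \<tau> - omega3 \<tau>"

(* The omega's are half-periods, so this is the lattice generated by 1 and \<tau>. *)
definition tau_lattice :: "complex \<Rightarrow> complex set" where
  "tau_lattice \<tau> = period_lattice (2 * omega1 \<tau>) (2 * omega3 \<tau>)"

definition e1 :: "complex \<Rightarrow> complex" where
  "e1 \<tau> = weierstrass_p (tau_lattice \<tau>) (omega1 \<tau>)"

definition e2 :: "complex \<Rightarrow> complex" where
  "e2 \<tau> = weierstrass_p (tau_lattice \<tau>) (omega2 \<tau>)"

definition e3 :: "complex \<Rightarrow> complex" where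
  "e3 \<tau> = weierstrass_p (tau_lattice \<tau>) (omega3 \<tau>)"

(* Half the quasi-period belonging to the period 1. *)
definition eta1 :: "complex \<Rightarrow> complex" where
  "eta1 \<tau> = weierstrass_zeta (tau_lattice \<tau>) (omega1 \<tau>)"

definition g2 :: "complex \<Rightarrow> complex" where
  "g2 \<tau> = - 4 * (e1 \<tau> * e2 \<tau> + e2 \<tau> * e3 \<tau> + e3 \<tau> * e1 \<tau>)"

end

theory Submission
  imports Defs "HOL-Complex_Analysis.Cauchy_Integral_Formula"
begin

text \<open>
  Put \<open>C(u) = \<pi>\<^sup>2 / sin\<^sup>2 (\<pi>u)\<close>, \<open>S(u) = \<pi> cot (\<pi>u)\<close>, so that \<open>C' = - 2SC\<close>. Summing the Weierstrass
  series along the rows \<open>m\<tau> + \<int>\<close> of the lattice gives \<open>2\<eta>\<^sub>1 = P(0) + \<pi>\<^sup>2/3\<close> and \<open>\<wp>(z) = P(z) - 2\<eta>\<^sub>1\<close>,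
  where \<open>P(z) = \<Sum> C(z + n\<tau>)\<close> and the pole of \<open>C\<close> at \<open>0\<close> is omitted. Differentiating termwise,
  \<open>2 d\<eta>\<^sub>1/d\<tau> = Q\<close> with \<open>Q = \<Sum> k C'(k\<tau>)\<close>.

  The addition theorem of the cotangent yields
  \<open>C(u) C(v) = C(u - v) (C(u) + C(v)) + C'(u - v) (S(v) - S(u))\<close>. Applied to all pairs in \<open>P(z)\<^sup>2\<close>, the
  differences of \<open>S\<close> telescope (\<open>S\<close> tends to \<open>\<mp>\<pi>\<i>\<close>) and, with \<open>B(z) = \<Sum> C(z + n\<tau>)\<^sup>2\<close>,
  \<open>P(z)\<^sup>2 = B(z) + 2 P(0) P(z) + 2\<pi>\<i> Q\<close>; omitting the pole in the same computation,
  \<open>0 = P(0)\<^sup>2 + 4\<pi>\<^sup>2 P(0) - 5 B(0) + 2\<pi>\<i> Q\<close>. The duplication formula of \<open>C\<close> evaluates the sums of \<open>P\<close> and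
  of \<open>B\<close> over the three half periods in terms of \<open>P(0)\<close> and \<open>B(0)\<close>. The first identity summed over the
  half periods then expresses \<open>g\<^sub>2 = 2(e\<^sub>1\<^sup>2 + e\<^sub>2\<^sup>2 + e\<^sub>3\<^sup>2)\<close>, and eliminating \<open>B(0)\<close> with the second gives
  the claim.
\<close>

section \<open>Sums over the integers\<close>

lemma has_sum_int_split:
  fixes f :: "int \<Rightarrow> 'a::{topological_comm_monoid_add}"
  assumes "((\<lambda>n::nat. f (int n)) has_sum a) UNIV"
    and "((\<lambda>n::nat. f (- int n - 1)) has_sum b) UNIV"
  shows "(f has_sum (a + b)) UNIV"
proof -
  have 1: "(f has_sum a) {0..}"
    using assms(1)
    by (subst (asm) has_sum_reindex_bij_witness[of UNIV nat int "{0..}" f _ a a]) auto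
  have 2: "(f has_sum b) {..<0}"
    using assms(2)
    by (subst (asm) has_sum_reindex_bij_witness
        [of UNIV "\<lambda>m. nat (- m - 1)" "\<lambda>n. - int n - 1" "{..<0}" f _ b b]) auto
  have "({0..} :: int set) \<union> {..<0} = UNIV" by auto
  moreover have "({0..} :: int set) \<inter> {..<0} = {}" by auto
  ultimately show ?thesis using has_sum_Un_disjoint[OF 1 2] by simp
qed

lemma summable_on_int_powr:
  fixes s :: real
  assumes "s < -1"
  shows "(\<lambda>n::int. (1 + \<bar>real_of_int n\<bar>) powr s) summable_on UNIV"
proof -
  have "summable (\<lambda>n. real n powr s)" using assms by (simp add: summable_real_powr_iff)
  hence 0: "summable (\<lambda>n. real (Suc n) powr s)" by (subst summable_Suc_iff)
  hence 1: "(\<lambda>n::nat. (1 + \<bar>real_of_int (int n)\<bar>) powr s) summable_on UNIV"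
    by (intro summable_nonneg_imp_summable_on) (simp_all add: add_ac)
  from 0 have "summable (\<lambda>n. real (Suc (Suc n)) powr s)" by (subst summable_Suc_iff)
  hence 2: "(\<lambda>n::nat. (1 + \<bar>real_of_int (- int n - 1)\<bar>) powr s) summable_on UNIV"
    by (intro summable_nonneg_imp_summable_on) (simp_all add: add_ac)
  show ?thesis
    using has_sum_int_split[OF has_sum_infsum[OF 1] has_sum_infsum[OF 2]]
    by (rule has_sum_imp_summable)
qed

lemma summable_on_int_power_bound:
  fixes f :: "int \<Rightarrow> 'a::banach"
  assumes "\<And>n. norm (f n) \<le> K / (1 + \<bar>real_of_int n\<bar>)\<^sup>2"
  shows "f summable_on UNIV"
proof -
  have "(\<lambda>n::int. K * (1 + \<bar>real_of_int n\<bar>) powr - 2) summable_on UNIV"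
    by (intro summable_on_cmult_right summable_on_int_powr) simp
  hence "(\<lambda>n. norm (f n)) summable_on UNIV"
    by (rule summable_on_comparison_test)
      (use assms in \<open>simp_all add: powr_minus powr_numeral field_simps\<close>)
  thus ?thesis by (rule abs_summable_summable)
qed

section \<open>Cotangent and squared cosecant\<close>

text \<open>
  The functions \<open>\<pi> cot (\<pi>u)\<close> and \<open>\<pi>\<^sup>2 / sin\<^sup>2 (\<pi>u)\<close>. At integers division by zero makes both \<open>0\<close>, so that
  sums over all integers omit the pole automatically.
\<close>

definition pcot :: "complex \<Rightarrow> complex" where
  "pcot u = (let E = exp (2 * of_real pi * \<i> * u) in of_real pi * \<i> * (E + 1) / (E - 1))"

definition pcsc2 :: "complex \<Rightarrow> complex" where
  "pcsc2 u = (let E = exp (2 * of_real pi * \<i> * u) in - 4 * (of_real pi)\<^sup>2 * E / (E - 1)\<^sup>2)"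

text \<open>Free of quotients, so that it covers the zeros of the sine; this lets
  \<open>pcsc2_sin\<close> hold at integers too.\<close>

lemma sin_sq_exp:
  "(sin (of_real pi * u))\<^sup>2 * (- 4 * exp (2 * of_real pi * \<i> * u)) = (exp (2 * of_real pi * \<i> * u) - 1)\<^sup>2"
proof -
  have a: "exp (2 * of_real pi * \<i> * u) = exp (\<i> * (of_real pi * u)) * exp (\<i> * (of_real pi * u))"
    by (simp add: exp_add [symmetric] algebra_simps)
  have b: "exp (- (\<i> * (of_real pi * u))) * exp (\<i> * (of_real pi * u)) = 1"
    by (simp add: exp_add [symmetric])
  show ?thesis
    unfolding sin_exp_eq a using b by (simp add: field_simps) algebra
qed

lemma pcsc2_sin: "pcsc2 u = (of_real pi)\<^sup>2 / (sin (of_real pi * u))\<^sup>2"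
proof -
  have "pcsc2 u = - 4 * (of_real pi)\<^sup>2 * exp (2 * of_real pi * \<i> * u) /
      ((sin (of_real pi * u))\<^sup>2 * (- 4 * exp (2 * of_real pi * \<i> * u)))"
    unfolding sin_sq_exp by (simp add: pcsc2_def Let_def)
  also have "\<dots> = (of_real pi)\<^sup>2 / (sin (of_real pi * u))\<^sup>2" by simp
  finally show ?thesis .
qed

section \<open>Partial fractions of the squared cosecant\<close>

lemma not_Int_imp_not_nonpos_Ints:
  fixes u :: complex
  assumes "u \<notin> \<int>"
  shows "u \<notin> \<int>\<^sub>\<le>\<^sub>0" "1 - u \<notin> \<int>\<^sub>\<le>\<^sub>0"
proof -
  show "u \<notin> \<int>\<^sub>\<le>\<^sub>0" using assms nonpos_Ints_Int by blast
  have "u \<in> \<int>" if "1 - u \<in> \<int>" using Ints_diff[OF Ints_1 that] by simp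
  thus "1 - u \<notin> \<int>\<^sub>\<le>\<^sub>0" using assms nonpos_Ints_Int by blast
qed

text \<open>Logarithmic derivative of Euler's reflection formula. The function
  \<open>rGamma z * rGamma (1 - z)\<close> is differentiated once by the product rule and once as
  sin(pi z)/pi.\<close>

lemma Digamma_reflection:
  fixes z :: complex
  assumes "z \<notin> \<int>"
  shows "Digamma (1 - z) - Digamma z = of_real pi * cot (of_real pi * z)"
proof -
  have nz: "z \<notin> \<int>\<^sub>\<le>\<^sub>0" "1 - z \<notin> \<int>\<^sub>\<le>\<^sub>0"
    using not_Int_imp_not_nonpos_Ints[OF assms] .
  have s: "sin (of_real pi * z) \<noteq> 0"
    using assms by (auto simp: sin_eq_0)
  have "((\<lambda>z. rGamma z * rGamma (1 - z)) has_field_derivative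
      - rGamma z * Digamma z * rGamma (1 - z) + rGamma z * (rGamma (1 - z) * Digamma (1 - z))) (at z)"
    using nz by (auto intro!: derivative_eq_intros)
  moreover have "((\<lambda>z. rGamma z * rGamma (1 - z)) has_field_derivative cos (of_real pi * z)) (at z)"
    unfolding rGamma_reflection_complex by (auto intro!: derivative_eq_intros)
  ultimately have "- rGamma z * Digamma z * rGamma (1 - z) + rGamma z * (rGamma (1 - z) * Digamma (1 - z)) =
      cos (of_real pi * z)"
    by (rule DERIV_unique)
  hence "rGamma z * rGamma (1 - z) * (Digamma (1 - z) - Digamma z) = cos (of_real pi * z)"
    by (simp add: algebra_simps)
  thus ?thesis
    unfolding rGamma_reflection_complex using s by (simp add: cot_def field_simps)
qed

text \<open>One more differentiation of \<open>Digamma_reflection\<close>. The two trigamma values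
  are the sums of 1/(z + n)^2 over n \<ge> 0 and over n < 0, so this is the partial fraction
  expansion of \<open>pcsc2\<close> in closed form.\<close>

lemma trigamma_reflection:
  fixes z :: complex
  assumes "z \<notin> \<int>"
  shows "Polygamma 1 z + Polygamma 1 (1 - z) = pcsc2 z"
proof -
  have nz: "z \<notin> \<int>\<^sub>\<le>\<^sub>0" "1 - z \<notin> \<int>\<^sub>\<le>\<^sub>0"
    using not_Int_imp_not_nonpos_Ints[OF assms] .
  have s: "sin (of_real pi * z) \<noteq> 0"
    using assms by (auto simp: sin_eq_0)
  have "((\<lambda>z. Digamma (1 - z) - Digamma z) has_field_derivative
      Polygamma (Suc 0) (1 - z) * (0 - 1) - Polygamma (Suc 0) z) (at z)"
    using nz
    by (intro DERIV_diff DERIV_chain2[of "Digamma" _ "\<lambda>z. 1 - z"] has_field_derivative_Polygamma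
        DERIV_const DERIV_ident) auto
  moreover have "((\<lambda>z. Digamma (1 - z) - Digamma z) has_field_derivative
      of_real pi * (- inverse ((sin (of_real pi * z))\<^sup>2) * of_real pi)) (at z)"
  proof (rule has_field_derivative_transform_within_open)
    show "((\<lambda>z. of_real pi * cot (of_real pi * z)) has_field_derivative
      of_real pi * (- inverse ((sin (of_real pi * z))\<^sup>2) * of_real pi)) (at z)"
      using s by (intro DERIV_cmult DERIV_chain2[OF DERIV_cot] DERIV_cmult_Id)
    show "open (- \<int> :: complex set)" by (auto intro: closed_Ints)
  qed (use assms Digamma_reflection in auto)
  ultimately have "Polygamma (Suc 0) (1 - z) * (0 - 1) - Polygamma (Suc 0) z =
      of_real pi * (- inverse ((sin (of_real pi * z))\<^sup>2) * of_real pi)"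
    by (rule DERIV_unique)
  hence "Polygamma 1 z + Polygamma 1 (1 - z) =
      of_real pi * (inverse ((sin (of_real pi * z))\<^sup>2) * of_real pi)"
    by (simp add: algebra_simps)
  thus ?thesis unfolding pcsc2_sin by (simp add: power2_eq_square divide_inverse mult_ac)
qed

lemma trigamma_has_sum:
  fixes z :: complex
  assumes "z \<notin> \<int>\<^sub>\<le>\<^sub>0"
  shows "((\<lambda>n::nat. 1 / (z + of_nat n)\<^sup>2) has_sum Polygamma 1 z) UNIV"
proof (rule norm_summable_imp_has_sum)
  show "(\<lambda>n. 1 / (z + of_nat n)\<^sup>2) sums Polygamma 1 z"
    using Polygamma_LIMSEQ[of z 1] assms by (auto simp: numeral_2_eq_2 field_simps)
  show "summable (\<lambda>n. norm (1 / (z + of_nat n)\<^sup>2))"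
  proof (rule summable_comparison_test_ev)
    show "summable (\<lambda>n. 4 * (1 / (of_nat n :: real)^2))"
      by (intro summable_mult inverse_power_summable[of 2, simplified inverse_eq_divide]) auto
    show "\<forall>\<^sub>F n in sequentially. norm (norm (1 / (z + of_nat n)\<^sup>2)) \<le> 4 * (1 / (of_nat n :: real)^2)"
      \<comment> \<open>From n \<ge> 2|z| on, |z + n| is at least n/2, which gives the factor 4; the
        added 1 keeps n positive.\<close>
      using eventually_ge_at_top[of "nat \<lceil>2 * norm z\<rceil> + 1"]
    proof eventually_elim
      case (elim n)
      hence n: "real n > 0" "real n \<ge> 2 * norm z" by linarith+
      have "norm (of_nat n :: complex) \<le> norm (z + of_nat n) + norm z"
        by (metis add_diff_cancel_left' norm_triangle_ineq4)
      hence "norm (z + of_nat n) \<ge> real n / 2" using n by simp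
      hence "norm (z + of_nat n) ^ 2 \<ge> (real n / 2)\<^sup>2" using n by (intro power_mono) auto
      moreover have "(real n / 2)\<^sup>2 > 0" using n by simp
      ultimately have "1 / norm (z + of_nat n) ^ 2 \<le> 1 / (real n / 2)\<^sup>2"
        by (intro divide_left_mono mult_pos_pos) auto
      thus ?case by (simp add: norm_divide norm_power field_simps)
    qed
  qed
qed

lemma pcsc2_has_sum:
  assumes "u \<notin> \<int>"
  shows "((\<lambda>n::int. 1 / (u + of_int n)\<^sup>2) has_sum pcsc2 u) UNIV"
proof -
  have nz: "u \<notin> \<int>\<^sub>\<le>\<^sub>0" "1 - u \<notin> \<int>\<^sub>\<le>\<^sub>0"
    using not_Int_imp_not_nonpos_Ints[OF assms] .
  \<comment> \<open>Up to sign, 1 - u + n is u + (-n - 1): the second trigamma series runs over the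
    negative integers.\<close>
  have e: "1 / (1 - u + of_nat n)\<^sup>2 = 1 / (u + of_int (- int n - 1))\<^sup>2" for n
    by (simp add: power2_eq_square algebra_simps)
  show ?thesis
    unfolding trigamma_reflection[OF assms, symmetric]
    using trigamma_has_sum[OF nz(1)] trigamma_has_sum[OF nz(2)]
    by (intro has_sum_int_split) (simp_all only: e of_int_of_nat_eq)
qed

text \<open>Twice the Basel sum, the term at \<open>n = 0\<close> being \<open>1 / 0 = 0\<close>. It
  is the contribution of the lattice row through the origin.\<close>

lemma has_sum_inverse_squares_int: "((\<lambda>n::int. 1 / (of_int n)\<^sup>2) has_sum ((of_real pi)\<^sup>2 / 3 :: complex)) UNIV"
proof -
  have "(\<lambda>n. 1 / (real (Suc n))\<^sup>2) = (\<lambda>n. 1 / real ((n + 1)\<^sup>2))"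
    by (simp only: Suc_eq_plus1 of_nat_power)
  hence S: "(\<lambda>n. 1 / (real (Suc n))\<^sup>2) sums (pi\<^sup>2 / 6)"
    using inverse_squares_sums by simp
  have 0: "((\<lambda>n::nat. 1 / (real n)\<^sup>2) has_sum pi\<^sup>2 / 6) UNIV"
    by (intro sums_nonneg_imp_has_sum sums_Suc_imp[OF _ S]) simp_all
  have 1: "((\<lambda>n::nat. 1 / (real n + 1)\<^sup>2) has_sum pi\<^sup>2 / 6) UNIV"
    using sums_nonneg_imp_has_sum[OF S] by (simp add: add.commute)
  have "(\<lambda>n::nat. 1 / (real_of_int (- int n - 1))\<^sup>2) = (\<lambda>n. 1 / (real n + 1)\<^sup>2)"
    by (simp add: power2_eq_square algebra_simps)
  hence "((\<lambda>n::int. 1 / (real_of_int n)\<^sup>2) has_sum pi\<^sup>2 / 6 + pi\<^sup>2 / 6) UNIV"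
    using 0 1 by (intro has_sum_int_split) simp_all
  from has_sum_of_real[OF this, where 'a = complex] show ?thesis by simp
qed

section \<open>Identities and bounds from the exponential form\<close>

abbreviation qexp :: "complex \<Rightarrow> complex" where
  "qexp u \<equiv> exp (2 * of_real pi * \<i> * u)"

lemma qexp_eq_1_iff: "qexp u = 1 \<longleftrightarrow> u \<in> \<int>"
proof -
  have "qexp u = 1 \<longleftrightarrow> sin (of_real pi * u) = 0"
    using sin_sq_exp[of u] by auto
  also have "\<dots> \<longleftrightarrow> (\<exists>n::int. of_real pi * u = of_real pi * of_int n)"
    by (simp add: sin_eq_0 mult.commute)
  also have "\<dots> \<longleftrightarrow> u \<in> \<int>" by (auto simp: Ints_def)
  finally show ?thesis .
qed

lemma pcot_0 [simp]: "pcot 0 = 0" and pcsc2_0 [simp]: "pcsc2 0 = 0"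
  by (simp_all add: pcot_def pcsc2_def)

lemma qexp_minus: "qexp (- u) = 1 / qexp u"
  by (simp add: exp_minus field_simps)

lemma pcsc2_minus: "pcsc2 (- u) = pcsc2 u"
proof (cases "qexp u = 1")
  case False
  have "(1 / qexp u - 1)\<^sup>2 = (qexp u - 1)\<^sup>2 / (qexp u)\<^sup>2"
    by (simp add: field_simps power2_eq_square)
  thus ?thesis using False
    unfolding pcsc2_def qexp_minus Let_def by (simp add: field_simps power2_eq_square)
qed (unfold pcsc2_def qexp_minus, simp)

lemma pcot_minus: "pcot (- u) = - pcot u"
proof (cases "qexp u = 1")
  case False
  hence "1 / qexp u - 1 \<noteq> 0" "qexp u - 1 \<noteq> 0" by (auto simp: field_simps)
  thus ?thesis
    unfolding pcot_def qexp_minus Let_def by (simp add: divide_simps) (simp add: algebra_simps)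
qed (unfold pcot_def qexp_minus, simp)

text \<open>At an integer the default values would turn this into \<open>0 = pi\<^sup>2\<close>,
  hence the hypothesis.\<close>

lemma pcsc2_eq_pcot:
  assumes "u \<notin> \<int>"
  shows "pcsc2 u = (pcot u)\<^sup>2 + (of_real pi)\<^sup>2"
proof -
  have "qexp u - 1 \<noteq> 0" using assms qexp_eq_1_iff[of u] by simp
  hence "- 4 * qexp u / (qexp u - 1)\<^sup>2 = 1 - (qexp u + 1)\<^sup>2 / (qexp u - 1)\<^sup>2"
    by (simp add: divide_simps) algebra
  moreover have "pcsc2 u = (of_real pi)\<^sup>2 * (- 4 * qexp u / (qexp u - 1)\<^sup>2)"
    by (simp add: pcsc2_def Let_def)
  moreover have "(pcot u)\<^sup>2 = - (of_real pi)\<^sup>2 * ((qexp u + 1)\<^sup>2 / (qexp u - 1)\<^sup>2)"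
    by (simp add: pcot_def Let_def power_divide power_mult_distrib)
  ultimately show ?thesis by (simp only: right_diff_distrib) simp
qed

text \<open>Addition theorem of the cotangent with its denominator cleared. The difference of the
  two cotangents carries a factor E - F, which cancels the denominator of
  \<open>pcot (u - v)\<close>.\<close>

lemma pcot_diff:
  assumes "u \<notin> \<int>" "v \<notin> \<int>" "u - v \<notin> \<int>"
  shows "pcot (u - v) * (pcot u - pcot v) = - (pcot u * pcot v + (of_real pi)\<^sup>2)"
proof -
  define E F where "E = qexp u" and "F = qexp v"
  have w: "qexp (u - v) = E / F"
    by (simp add: E_def F_def exp_diff [symmetric] algebra_simps)
  have nz: "E - 1 \<noteq> 0" "F - 1 \<noteq> 0" "F \<noteq> 0" "E - F \<noteq> 0"
    using assms qexp_eq_1_iff[of u] qexp_eq_1_iff[of v] qexp_eq_1_iff[of "u - v"] w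
    by (auto simp: E_def F_def)
  have 1: "pcot (u - v) = of_real pi * \<i> * ((E + F) / (E - F))"
    using nz unfolding pcot_def w Let_def by (simp add: divide_simps)
  have 2: "pcot u = of_real pi * \<i> * ((E + 1) / (E - 1))" "pcot v = of_real pi * \<i> * ((F + 1) / (F - 1))"
    by (simp_all add: pcot_def Let_def E_def F_def)
  have 3: "(E + 1) / (E - 1) - (F + 1) / (F - 1) = - 2 * (E - F) / ((E - 1) * (F - 1))"
    using nz by (simp add: field_simps)
  have gen: "(of_real pi * \<i> * a) * (of_real pi * \<i> * b - of_real pi * \<i> * c) = - (of_real pi)\<^sup>2 * a * (b - c)"
    for a b c by (simp add: algebra_simps power2_eq_square)
  have "pcot (u - v) * (pcot u - pcot v) =
      - (of_real pi)\<^sup>2 * ((E + F) / (E - F)) * ((E + 1) / (E - 1) - (F + 1) / (F - 1))"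
    unfolding 1 2 by (rule gen)
  also have "\<dots> = 2 * (of_real pi)\<^sup>2 * (E + F) / ((E - 1) * (F - 1))"
    unfolding 3 using nz by (simp add: divide_simps) algebra
  also have "\<dots> = - (pcot u * pcot v + (of_real pi)\<^sup>2)"
    unfolding 2 using nz by (simp add: divide_simps power2_eq_square) (simp add: algebra_simps)
  finally show ?thesis .
qed

text \<open>The derivative of \<^term>\<open>pcsc2\<close> off the integers.\<close>

definition dpcsc2 :: "complex \<Rightarrow> complex" where
  "dpcsc2 u = - 2 * pcot u * pcsc2 u"

text \<open>By \<open>pcot_diff\<close> the right-hand side collapses to
  \<open>pcsc2 (u - v) * (pcot u - pcot v)\<^sup>2\<close>; a second use of it turns this into (S(u)
  S(v) + pi^2)^2 + pi^2 (S(u) - S(v))^2, which factors as the product on the left.\<close>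

lemma pcsc2_mult:
  assumes "u \<notin> \<int>" "v \<notin> \<int>" "u - v \<notin> \<int>"
  shows "pcsc2 u * pcsc2 v =
    pcsc2 (u - v) * (pcsc2 u + pcsc2 v) + dpcsc2 (u - v) * (pcot v - pcot u)"
  using pcot_diff[OF assms] unfolding dpcsc2_def
  unfolding pcsc2_eq_pcot[OF assms(1)] pcsc2_eq_pcot[OF assms(2)] pcsc2_eq_pcot[OF assms(3)]
  by algebra

text \<open>Adding 1/2 to u replaces E by -E, doubling u replaces E by E^2. Sum and product of the
  two values are both constant multiples of \<open>pcsc2 (2 * u)\<close>, and they determine the sum
  of squares.\<close>

lemma pcsc2_half_shift:
  "pcsc2 u + pcsc2 (u + 1/2) = 4 * pcsc2 (2 * u)"
  "(pcsc2 u)\<^sup>2 + (pcsc2 (u + 1/2))\<^sup>2 = 16 * (pcsc2 (2 * u))\<^sup>2 - 8 * (of_real pi)\<^sup>2 * pcsc2 (2 * u)"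
  if "2 * u \<notin> \<int>"
proof -
  define E where "E = qexp u"
  have h: "qexp (1/2) = -1" by (simp add: exp_Euler)
  have 1: "qexp (u + 1/2) = - E" 
    using h by (simp add: E_def exp_add distrib_left)
  have 2: "qexp (2 * u) = E\<^sup>2"
    by (simp add: E_def exp_double [symmetric] mult_ac)
  have nz: "E\<^sup>2 - 1 \<noteq> 0" using that qexp_eq_1_iff[of "2 * u"] 2 by simp
  moreover have "E\<^sup>2 - 1 = (E - 1) * (E + 1)" by algebra
  ultimately have nz': "E - 1 \<noteq> 0" "E + 1 \<noteq> 0" by simp_all
  have c1: "pcsc2 u = - 4 * (of_real pi)\<^sup>2 * E / (E - 1)\<^sup>2"
    by (simp add: pcsc2_def E_def Let_def)
  have "(- E - 1)\<^sup>2 = (E + 1)\<^sup>2" by (simp add: power2_eq_square algebra_simps)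
  hence c2: "pcsc2 (u + 1/2) = 4 * (of_real pi)\<^sup>2 * E / (E + 1)\<^sup>2"
    unfolding pcsc2_def 1 Let_def by simp
  have "(E\<^sup>2 - 1)\<^sup>2 = ((E - 1) * (E + 1))\<^sup>2" by algebra
  hence c3: "pcsc2 (2 * u) = - 4 * (of_real pi)\<^sup>2 * E\<^sup>2 / ((E - 1)\<^sup>2 * (E + 1)\<^sup>2)"
    unfolding pcsc2_def 2 Let_def by (simp add: power_mult_distrib)
  show s: "pcsc2 u + pcsc2 (u + 1/2) = 4 * pcsc2 (2 * u)"
    unfolding c1 c2 c3 using nz' by (simp add: divide_simps) algebra
  have p: "pcsc2 u * pcsc2 (u + 1/2) = 4 * (of_real pi)\<^sup>2 * pcsc2 (2 * u)"
    unfolding c1 c2 c3 using nz' by (simp add: divide_simps) algebra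
  show "(pcsc2 u)\<^sup>2 + (pcsc2 (u + 1/2))\<^sup>2 = 16 * (pcsc2 (2 * u))\<^sup>2 - 8 * (of_real pi)\<^sup>2 * pcsc2 (2 * u)"
    using s p by algebra
qed

lemma pcsc2_half: "pcsc2 (1/2) = (of_real pi)\<^sup>2"
  by (simp add: pcsc2_def exp_Euler)

lemma pcsc2_has_field_derivative:
  assumes "u \<notin> \<int>"
  shows "(pcsc2 has_field_derivative dpcsc2 u) (at u)"
proof -
  have nz: "qexp u - 1 \<noteq> 0" using assms qexp_eq_1_iff[of u] by simp
  show ?thesis
    unfolding pcsc2_def[abs_def] Let_def dpcsc2_def pcot_def
    apply (rule derivative_eq_intros refl)+
    using nz apply simp
    using nz by (simp add: divide_simps) algebra
qed

text \<open>High in the upper half plane the exponential is small, so \<open>pcsc2\<close> is of its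
  size and \<open>pcot\<close> is close to its limit -pi i. Parity gives the lower half plane, with
  limit +pi i.\<close>

lemma pcsc2_pcot_bounds:
  assumes "y0 > 0"
  obtains K where "K > 0"
    "\<And>u. y0 \<le> \<bar>Im u\<bar> \<Longrightarrow> norm (pcsc2 u) \<le> K * exp (- 2 * pi * \<bar>Im u\<bar>)"
    "\<And>u. y0 \<le> \<bar>Im u\<bar> \<Longrightarrow> norm (pcot u) \<le> K"
    "\<And>u. y0 \<le> \<bar>Im u\<bar> \<Longrightarrow> norm (pcot u + of_real (sgn (Im u)) * (of_real pi * \<i>)) \<le> K * exp (- 2 * pi * \<bar>Im u\<bar>)"
proof -
  \<comment> \<open>\<open>d\<close> bounds |E - 1| from below once Im u \<ge> y0. The constant
    \<open>K\<close> is dictated by \<open>pcsc2\<close> and also dominates 2 pi / d, which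
    \<open>pcot\<close> requires.\<close>
  define d where "d = 1 - exp (- 2 * pi * y0)"
  have d: "0 < d" "d \<le> 1" using assms by (auto simp: d_def)
  define K where "K = 4 * pi\<^sup>2 / d\<^sup>2"
  have "2 * pi / d \<le> K"
  proof -
    have "pi * d \<le> 2 * pi\<^sup>2"
      using d pi_ge_two mult_mono[of pi pi d pi] by (simp add: power2_eq_square)
    thus ?thesis using d by (simp add: K_def divide_simps power2_eq_square)
  qed
  have K: "K > 0" using d by (simp add: K_def)
  have main: "norm (pcsc2 u) \<le> K * exp (- 2 * pi * \<bar>Im u\<bar>) \<and> norm (pcot u) \<le> K \<and>
      norm (pcot u + of_real pi * \<i>) \<le> K * exp (- 2 * pi * \<bar>Im u\<bar>)" if u: "y0 \<le> Im u" for u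
  proof -
    have pos: "Im u > 0" using u assms by simp
    have nE: "norm (qexp u) = exp (- 2 * pi * \<bar>Im u\<bar>)" using pos by (simp add: norm_exp_eq_Re)
    have le: "norm (qexp u) \<le> 1 - d" unfolding nE d_def using u pos by simp
    have dn: "d \<le> norm (qexp u - 1)"
      using norm_triangle_ineq2[of 1 "qexp u"] le by (simp add: norm_minus_commute)
    hence nz: "qexp u - 1 \<noteq> 0" using d by auto
    have dn2: "d\<^sup>2 \<le> (norm (qexp u - 1))\<^sup>2" using dn d by (intro power_mono) auto
    have "norm (pcsc2 u) = 4 * pi\<^sup>2 * norm (qexp u) / (norm (qexp u - 1))\<^sup>2"
      by (simp add: pcsc2_def Let_def norm_mult norm_divide norm_power)
    also have "\<dots> \<le> 4 * pi\<^sup>2 * norm (qexp u) / d\<^sup>2"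
      using dn2 d by (intro divide_left_mono mult_pos_pos) (auto simp: nz)
    also have "\<dots> = K * norm (qexp u)" by (simp add: K_def)
    finally have 1: "norm (pcsc2 u) \<le> K * exp (- 2 * pi * \<bar>Im u\<bar>)" unfolding nE .
    have "norm (qexp u + 1) \<le> 2"
      using norm_triangle_ineq[of "qexp u" 1] le d by simp
    hence "norm (pcot u) \<le> pi * 2 / d"
      unfolding pcot_def Let_def norm_mult norm_divide
      using dn d by (intro frac_le) auto
    hence 2: "norm (pcot u) \<le> K" using \<open>2 * pi / d \<le> K\<close> by (simp add: mult_ac)
    have "pcot u + of_real pi * \<i> = 2 * of_real pi * \<i> * qexp u / (qexp u - 1)"
      unfolding pcot_def Let_def using nz by (simp add: divide_simps) (simp add: algebra_simps)
    hence "norm (pcot u + of_real pi * \<i>) = 2 * pi * norm (qexp u) / norm (qexp u - 1)"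
      by (simp add: norm_mult norm_divide)
    also have "\<dots> \<le> 2 * pi * norm (qexp u) / d"
      using dn d by (intro divide_left_mono mult_pos_pos) (auto simp: nz)
    also have "\<dots> = 2 * pi / d * norm (qexp u)" by simp
    also have "\<dots> \<le> K * norm (qexp u)" using \<open>2 * pi / d \<le> K\<close> by (intro mult_right_mono) auto
    finally have 3: "norm (pcot u + of_real pi * \<i>) \<le> K * exp (- 2 * pi * \<bar>Im u\<bar>)" unfolding nE .
    show ?thesis using 1 2 3 by blast
  qed
  have neg: "norm (pcot u - of_real pi * \<i>) = norm (pcot (- u) + of_real pi * \<i>)" for u
    by (simp add: pcot_minus norm_minus_commute)
  show ?thesis
  proof (rule that[OF K])
    fix u :: complex assume u: "y0 \<le> \<bar>Im u\<bar>"
    hence "y0 \<le> Im u \<or> y0 \<le> Im (- u)" by auto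
    thus "norm (pcsc2 u) \<le> K * exp (- 2 * pi * \<bar>Im u\<bar>)" 
         "norm (pcot u) \<le> K"
      using main[of u] main[of "- u"] by (auto simp: pcsc2_minus pcot_minus)
    show "norm (pcot u + of_real (sgn (Im u)) * (of_real pi * \<i>)) \<le> K * exp (- 2 * pi * \<bar>Im u\<bar>)"
    proof (cases "Im u > 0")
      case True thus ?thesis using main[of u] u by simp
    next
      case False thus ?thesis using main[of "- u"] neg[of u] u assms by (simp add: sgn_if)
    qed
  qed
qed

section \<open>Shifts, telescoping and products of sums over the integers\<close>

lemma has_sum_int_shift:
  fixes f :: "int \<Rightarrow> 'a::{topological_comm_monoid_add}"
  assumes "(f has_sum s) UNIV"
  shows "((\<lambda>n. f (n + k)) has_sum s) UNIV"
  using assms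
  by (subst has_sum_reindex_bij_witness[of UNIV "\<lambda>n. n - k" "\<lambda>n. n + k" UNIV f _ s s]) auto

lemma has_sum_int_uminus:
  fixes f :: "int \<Rightarrow> 'a::{topological_comm_monoid_add}"
  assumes "(f has_sum s) UNIV"
  shows "((\<lambda>n. f (- n)) has_sum s) UNIV"
  using assms
  by (subst has_sum_reindex_bij_witness[of UNIV uminus uminus UNIV f _ s s]) auto

lemma has_sum_int_parity:
  fixes f :: "int \<Rightarrow> 'a::{topological_comm_monoid_add}"
  assumes "((\<lambda>n. f (2 * n)) has_sum a) UNIV" "((\<lambda>n. f (2 * n + 1)) has_sum b) UNIV"
  shows "(f has_sum (a + b)) UNIV"
proof -
  have 1: "(f has_sum a) {n. even n}"
    using assms(1)
    by (subst (asm) has_sum_reindex_bij_witness[of UNIV "\<lambda>n. n div 2" "\<lambda>n. 2 * n" "{n. even n}" f _ a a]) auto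
  have 2: "(f has_sum b) {n. odd n}"
    using assms(2)
    by (subst (asm) has_sum_reindex_bij_witness[of UNIV "\<lambda>n. n div 2" "\<lambda>n. 2 * n + 1" "{n. odd n}" f _ b b]) auto
  have "{n. even n} \<union> {n. odd n} = (UNIV :: int set)" "{n. even n} \<inter> {n. odd n} = ({} :: int set)"
    by auto
  with has_sum_Un_disjoint[OF 1 2] show ?thesis by simp
qed

lemma has_sum_single: "((\<lambda>n. if n = k then c else 0) has_sum c) UNIV"
  by (rule has_sum_finite_neutralI[of "{k}"]) auto

lemma has_sum_diff:
  fixes f g :: "'a \<Rightarrow> 'b::real_normed_vector"
  assumes "(f has_sum a) A" "(g has_sum b) A"
  shows "((\<lambda>x. f x - g x) has_sum (a - b)) A"
  using has_sum_add[OF assms(1), of "\<lambda>x. - g x" "- b"] assms(2) by (simp add: has_sum_uminus)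

text \<open>Here \<open>f\<close> tends to \<open>b\<close> on the right and to \<open>a\<close> on
  the left. After subtracting the step function \<open>h\<close> the rest is summable, so its
  shifted differences cancel; those of \<open>h\<close> are nonzero at no more than |k|
  places.\<close>

lemma has_sum_int_telescope:
  fixes f :: "int \<Rightarrow> 'a::real_normed_field"
  assumes "(\<lambda>n. f n - (if n \<ge> 0 then b else a)) summable_on UNIV"
  shows "((\<lambda>n. f n - f (n + k)) has_sum (of_int k * (a - b))) UNIV"
proof -
  define h where "h n = (if n \<ge> 0 then b else a)" for n :: int
  obtain s where s: "((\<lambda>n. f n - h n) has_sum s) UNIV"
    using assms by (auto simp: summable_on_def h_def)
  have 1: "((\<lambda>n. (f n - h n) - (f (n + k) - h (n + k))) has_sum (s - s)) UNIV"
    by (intro has_sum_diff s has_sum_int_shift[OF s])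
  have 2: "((\<lambda>n. h n - h (n + k)) has_sum (of_int k * (a - b))) UNIV"
  proof (cases "k \<ge> 0")
    case True
    have "(\<Sum>n\<in>{-k..<0}. h n - h (n + k)) = (\<Sum>n\<in>{-k..<0}. a - b)"
      by (intro sum.cong) (auto simp: h_def)
    thus ?thesis using True
      by (intro has_sum_finite_neutralI[of "{-k..<0}"]) (auto simp: h_def)
  next
    case False
    have "(\<Sum>n\<in>{0..<-k}. h n - h (n + k)) = (\<Sum>n\<in>{0..<-k}. b - a)"
      by (intro sum.cong) (auto simp: h_def)
    thus ?thesis using False
      by (intro has_sum_finite_neutralI[of "{0..<-k}"]) (auto simp: h_def algebra_simps)
  qed
  from has_sum_add[OF 1 2] show ?thesis by simp
qed

text \<open>The square as a double sum, sorted by the difference \<open>k\<close> of the two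
  indices; absolute convergence permits the rearrangement.\<close>

lemma has_sum_int_autocorrelation:
  fixes c h :: "int \<Rightarrow> complex"
  assumes c: "(c has_sum S) UNIV"
    and h: "\<And>k. ((\<lambda>n. c (n + k) * c n) has_sum h k) UNIV"
  shows "(h has_sum S\<^sup>2) UNIV"
proof -
  have abs: "(\<lambda>n. norm (c n)) summable_on UNIV"
    using c has_sum_imp_summable summable_on_iff_abs_summable_on_complex by blast
  have "(\<lambda>(m, n). norm (c m) * norm (c n)) summable_on (UNIV \<times> UNIV)"
    by (rule summable_on_SigmaI[where g = "\<lambda>m. norm (c m) * (\<Sum>\<^sub>\<infinity>n. norm (c n))"])
      (auto intro!: has_sum_cmult_right has_sum_infsum abs summable_on_cmult_left)
  hence "(\<lambda>p. norm (c (fst p) * c (snd p))) summable_on (UNIV \<times> UNIV)"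
    by (simp add: norm_mult case_prod_unfold)
  hence sm: "(\<lambda>p. c (fst p) * c (snd p)) summable_on (UNIV \<times> UNIV)"
    by (rule abs_summable_summable)
  have "((\<lambda>p. c (fst p) * c (snd p)) has_sum S * S) (UNIV \<times> UNIV)"
    by (rule has_sum_SigmaI[where g = "\<lambda>m. c m * S"])
      (use sm in \<open>auto intro!: has_sum_cmult_right has_sum_cmult_left c\<close>)
  hence "((\<lambda>p. c (snd p + fst p) * c (snd p)) has_sum S * S) (UNIV \<times> UNIV)"
    by (subst has_sum_reindex_bij_witness[of _ "\<lambda>(m, n). (m - n, n)" "\<lambda>(k, n). (n + k, n)"
        "UNIV \<times> UNIV" "\<lambda>p. c (fst p) * c (snd p)" _ "S * S" "S * S"]) auto
  from has_sum_SigmaD[OF this] h show ?thesis by (simp add: power2_eq_square)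
qed

lemma summable_on_int_bound:
  fixes f :: "int \<Rightarrow> 'a::banach"
  assumes "\<And>n. n \<noteq> 0 \<Longrightarrow> norm (f n) \<le> K / (1 + \<bar>real_of_int n\<bar>)\<^sup>2"
  shows "f summable_on UNIV"
proof (rule summable_on_int_power_bound)
  fix n :: int
  show "norm (f n) \<le> max K (norm (f 0)) / (1 + \<bar>real_of_int n\<bar>)\<^sup>2"
  proof (cases "n = 0")
    case False
    show ?thesis
      by (rule order_trans[OF assms[OF False] divide_right_mono]) auto
  qed auto
qed

lemma has_sum_int_imp_sums:
  fixes f :: "int \<Rightarrow> complex"
  assumes "(f has_sum s) UNIV"
  shows "(\<lambda>n. f (int n) + f (- int n - 1)) sums s"
proof -
  have sm: "f summable_on UNIV" using assms by (rule has_sum_imp_summable)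
  have 1: "(\<lambda>n::nat. f (int n)) summable_on UNIV"
    using summable_on_subset[OF sm, of "{0..}"]
    by (subst summable_on_reindex_bij_witness[of UNIV nat int "{0..}" f]) auto
  have 2: "(\<lambda>n::nat. f (- int n - 1)) summable_on UNIV"
    using summable_on_subset[OF sm, of "{..<0}"]
    by (subst summable_on_reindex_bij_witness
        [of UNIV "\<lambda>m. nat (- m - 1)" "\<lambda>n. - int n - 1" "{..<0}" f]) auto
  note h = has_sum_infsum[OF 1] has_sum_infsum[OF 2]
  show ?thesis
    using has_sum_imp_sums[OF has_sum_add[OF h]] has_sum_unique[OF has_sum_int_split[OF h] assms] by simp
qed

text \<open>Meant for F(n) = 1/(w + n), which is not itself summable, so the shift argument of
  \<open>has_sum_int_telescope\<close> does not apply. Summability of the differences is assumed and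
  the value is read off from partial sums.\<close>

lemma has_sum_int_telescope_null:
  fixes F :: "int \<Rightarrow> complex"
  assumes "(\<lambda>n. F n - F (n - 1)) summable_on UNIV"
    and "(\<lambda>N. F (int N)) \<longlonglongrightarrow> 0" "(\<lambda>N. F (- int N)) \<longlonglongrightarrow> 0"
  shows "((\<lambda>n. F n - F (n - 1)) has_sum 0) UNIV"
proof -
  obtain s where s: "((\<lambda>n. F n - F (n - 1)) has_sum s) UNIV"
    using assms(1) by (auto simp: summable_on_def)
  have "(\<Sum>n<N. (F (int n) - F (int n - 1)) + (F (- int n - 1) - F (- int n - 1 - 1)))
      = F (int N - 1) - F (- int N - 1)" for N
    by (induction N) (simp_all add: algebra_simps)
  hence "(\<lambda>N. F (int N - 1) - F (- int N - 1)) \<longlonglongrightarrow> s"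
    using has_sum_int_imp_sums[OF s] by (simp add: sums_def)
  hence "(\<lambda>N. F (int (Suc N) - 1) - F (- int (Suc N) - 1)) \<longlonglongrightarrow> s"
    by (rule LIMSEQ_Suc)
  moreover have "(\<lambda>N. F (int N) - F (- int (N + 2))) \<longlonglongrightarrow> 0 - 0"
    by (intro tendsto_diff assms(2) LIMSEQ_ignore_initial_segment[OF assms(3)])
  moreover have "F (int N) - F (- int (N + 2)) = F (int (Suc N) - 1) - F (- int (Suc N) - 1)" for N
    by (simp add: algebra_simps)
  ultimately have "s = 0" using LIMSEQ_unique by fastforce
  thus ?thesis using s by simp
qed

lemma LIMSEQ_inverse_of_nat_shift: "(\<lambda>N. 1 / (u + of_nat N :: complex)) \<longlonglongrightarrow> 0"
  by (intro tendsto_divide_0[OF tendsto_const] tendsto_add_filterlim_at_infinity[OF tendsto_const] tendsto_of_nat)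

section \<open>Decay away from the real axis\<close>

text \<open>The third power is chosen so that square decay survives multiplication by an index, as
  in \<open>dpcsc2_summable\<close>.\<close>

lemma exp_decay_cubic:
  fixes c :: real
  assumes "c > 0"
  obtains M where "M > 0" "\<And>x. x \<ge> 0 \<Longrightarrow> exp (- (c * x)) \<le> M / (1 + x) ^ 3"
proof
  \<comment> \<open>Chosen so that m (1 + x) \<le> 1 + c x / 3 \<le> exp(c x / 3); then
    cube.\<close>
  define m where "m = min 1 (c / 3)"
  have m: "m > 0" "m \<le> 1" "m \<le> c / 3" using assms by (auto simp: m_def)
  show "1 / m ^ 3 > 0" using m by simp
  fix x :: real assume x: "x \<ge> 0"
  have "m * (1 + x) \<le> 1 + c / 3 * x"
    using m x mult_right_mono[of m "c / 3" x] by (simp add: distrib_left)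
  also have "\<dots> \<le> exp (c / 3 * x)" by (rule exp_ge_add_one_self)
  finally have "(m * (1 + x)) ^ 3 \<le> exp (c / 3 * x) ^ 3"
    using m x by (intro power_mono) auto
  also have "exp (c / 3 * x) ^ 3 = exp (c * x)" by (simp add: exp_of_nat_mult [symmetric])
  finally have "1 / exp (c * x) \<le> 1 / (m * (1 + x)) ^ 3"
    using m x by (intro divide_left_mono mult_pos_pos) auto
  thus "exp (- (c * x)) \<le> 1 / m ^ 3 / (1 + x) ^ 3"
    by (simp add: exp_minus inverse_eq_divide power_mult_distrib)
qed

lemma pcsc2_pcot_cubic_decay:
  fixes t :: real
  assumes t: "t > 0"
  obtains K where "K > 0"
    "\<And>u x. 1 \<le> x \<Longrightarrow> x * t \<le> \<bar>Im u\<bar> \<Longrightarrow> norm (pcsc2 u) \<le> K / (1 + x) ^ 3"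
    "\<And>u x. 1 \<le> x \<Longrightarrow> x * t \<le> \<bar>Im u\<bar> \<Longrightarrow> norm (pcot u) \<le> K"
    "\<And>u x. 1 \<le> x \<Longrightarrow> x * t \<le> \<bar>Im u\<bar> \<Longrightarrow>
      norm (pcot u + of_real (sgn (Im u)) * (of_real pi * \<i>)) \<le> K / (1 + x) ^ 3"
proof -
  obtain K where K: "K > 0"
    "\<And>u. t \<le> \<bar>Im u\<bar> \<Longrightarrow> norm (pcsc2 u) \<le> K * exp (- 2 * pi * \<bar>Im u\<bar>)"
    "\<And>u. t \<le> \<bar>Im u\<bar> \<Longrightarrow> norm (pcot u) \<le> K"
    "\<And>u. t \<le> \<bar>Im u\<bar> \<Longrightarrow> norm (pcot u + of_real (sgn (Im u)) * (of_real pi * \<i>)) \<le> K * exp (- 2 * pi * \<bar>Im u\<bar>)"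
    using pcsc2_pcot_bounds[OF t] by metis
  obtain M where M: "M > 0" "\<And>x. x \<ge> 0 \<Longrightarrow> exp (- (2 * pi * t * x)) \<le> M / (1 + x) ^ 3"
    using exp_decay_cubic[of "2 * pi * t"] t by auto
  have *: "t \<le> \<bar>Im u\<bar> \<and> K * exp (- 2 * pi * \<bar>Im u\<bar>) \<le> max K (K * M) / (1 + x) ^ 3"
    if "1 \<le> x" "x * t \<le> \<bar>Im u\<bar>" for u x
  proof
    show "t \<le> \<bar>Im u\<bar>" using that t mult_right_mono[of 1 x t] by linarith
    have "2 * pi * (x * t) \<le> 2 * pi * \<bar>Im u\<bar>" using that by (intro mult_left_mono) auto
    hence "exp (- 2 * pi * \<bar>Im u\<bar>) \<le> exp (- (2 * pi * t * x))"
      by (simp add: mult_ac)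
    also have "\<dots> \<le> M / (1 + x) ^ 3" using M that by simp
    finally have "K * exp (- 2 * pi * \<bar>Im u\<bar>) \<le> K * (M / (1 + x) ^ 3)"
      using K(1) by (intro mult_left_mono) auto
    also have "\<dots> \<le> max K (K * M) / (1 + x) ^ 3"
      using that by (simp add: divide_right_mono)
    finally show "K * exp (- 2 * pi * \<bar>Im u\<bar>) \<le> max K (K * M) / (1 + x) ^ 3" .
  qed
  show ?thesis
  proof (rule that[of "max K (K * M)"])
    show "0 < max K (K * M)" using K(1) by simp
  next
    fix u :: complex and x :: real assume u: "1 \<le> x" "x * t \<le> \<bar>Im u\<bar>"
    show "norm (pcsc2 u) \<le> max K (K * M) / (1 + x) ^ 3"
      using *[OF u] K(2)[of u] by linarith
    show "norm (pcot u) \<le> max K (K * M)"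
      using *[OF u] K(3)[of u] by linarith
    show "norm (pcot u + of_real (sgn (Im u)) * (of_real pi * \<i>)) \<le> max K (K * M) / (1 + x) ^ 3"
      using *[OF u] K(4)[of u] by linarith
  qed
qed

section \<open>Row sums over a lattice\<close>

locale upper_half =
  fixes \<tau> :: complex
  assumes Im_pos: "Im \<tau> > 0"
begin

lemma int_mult_not_Int: "of_int k * \<tau> \<notin> \<int>" if "k \<noteq> 0"
  using that Im_pos complex_is_Int_iff by auto

text \<open>The strip is just high enough to contain the half periods. For n \<noteq> 0 the offset
  \<open>z\<close> costs at most half of |n| Im \<tau> and cannot change the sign.\<close>

lemma Im_row:
  assumes "\<bar>Im z\<bar> \<le> Im \<tau> / 2" "n \<noteq> 0"
  shows "1 \<le> \<bar>real_of_int n\<bar>" "\<bar>real_of_int n\<bar> * (Im \<tau> / 2) \<le> \<bar>Im (z + of_int n * \<tau>)\<bar>"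
    "sgn (Im (z + of_int n * \<tau>)) = sgn (real_of_int n)"
proof -
  show 1: "1 \<le> \<bar>real_of_int n\<bar>" using assms(2) by linarith
  have le: "Im \<tau> \<le> \<bar>real_of_int n\<bar> * Im \<tau>" using 1 Im_pos by simp
  show "\<bar>real_of_int n\<bar> * (Im \<tau> / 2) \<le> \<bar>Im (z + of_int n * \<tau>)\<bar>"
  proof -
    have "\<bar>real_of_int n\<bar> * Im \<tau> = \<bar>real_of_int n * Im \<tau>\<bar>" using Im_pos by (simp add: abs_mult)
    also have "\<dots> \<le> \<bar>Im (z + of_int n * \<tau>)\<bar> + \<bar>Im z\<bar>" by simp
    finally show ?thesis using assms(1) le by simp
  qed
  show "sgn (Im (z + of_int n * \<tau>)) = sgn (real_of_int n)"
  proof (cases "n > 0")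
    case True
    hence "Im \<tau> \<le> real_of_int n * Im \<tau>" using le by (simp only: abs_of_pos of_int_0_less_iff)
    hence "Im z + real_of_int n * Im \<tau> > 0" using assms(1) Im_pos by linarith
    thus ?thesis using True by (simp add: sgn_if)
  next
    case False
    hence "\<bar>real_of_int n\<bar> = - real_of_int n" using assms(2) by simp
    hence "Im \<tau> \<le> - (real_of_int n * Im \<tau>)" using le by (simp only: mult_minus_left)
    hence "Im z + real_of_int n * Im \<tau> < 0" using assms(1) Im_pos by linarith
    thus ?thesis using False assms(2) by (simp add: sgn_if)
  qed
qed

lemma row_bounds:
  obtains K where "K > 0"
    "\<And>z n. \<bar>Im z\<bar> \<le> Im \<tau> / 2 \<Longrightarrow> n \<noteq> 0 \<Longrightarrow> norm (pcsc2 (z + of_int n * \<tau>)) \<le> K / (1 + \<bar>real_of_int n\<bar>) ^ 3"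
    "\<And>z n. \<bar>Im z\<bar> \<le> Im \<tau> / 2 \<Longrightarrow> n \<noteq> 0 \<Longrightarrow> norm (pcot (z + of_int n * \<tau>)) \<le> K"
    "\<And>z n. \<bar>Im z\<bar> \<le> Im \<tau> / 2 \<Longrightarrow> n \<noteq> 0 \<Longrightarrow>
      norm (pcot (z + of_int n * \<tau>) - (if n \<ge> 0 then - (of_real pi * \<i>) else of_real pi * \<i>))
        \<le> K / (1 + \<bar>real_of_int n\<bar>) ^ 3"
proof -
  have "Im \<tau> / 2 > 0" using Im_pos by simp
  then obtain K where K: "K > 0"
    "\<And>u x. 1 \<le> x \<Longrightarrow> x * (Im \<tau> / 2) \<le> \<bar>Im u\<bar> \<Longrightarrow> norm (pcsc2 u) \<le> K / (1 + x) ^ 3"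
    "\<And>u x. 1 \<le> x \<Longrightarrow> x * (Im \<tau> / 2) \<le> \<bar>Im u\<bar> \<Longrightarrow> norm (pcot u) \<le> K"
    "\<And>u x. 1 \<le> x \<Longrightarrow> x * (Im \<tau> / 2) \<le> \<bar>Im u\<bar> \<Longrightarrow>
      norm (pcot u + of_real (sgn (Im u)) * (of_real pi * \<i>)) \<le> K / (1 + x) ^ 3"
    using pcsc2_pcot_cubic_decay by metis
  show ?thesis
  proof (rule that[OF K(1)])
    fix z :: complex and n :: int assume a: "\<bar>Im z\<bar> \<le> Im \<tau> / 2" "n \<noteq> 0"
    note r = Im_row[OF a]
    show "norm (pcsc2 (z + of_int n * \<tau>)) \<le> K / (1 + \<bar>real_of_int n\<bar>) ^ 3"
      "norm (pcot (z + of_int n * \<tau>)) \<le> K"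
      using K(2,3)[OF r(1,2)] by auto
    show "norm (pcot (z + of_int n * \<tau>) - (if n \<ge> 0 then - (of_real pi * \<i>) else of_real pi * \<i>))
        \<le> K / (1 + \<bar>real_of_int n\<bar>) ^ 3"
      using K(4)[OF r(1,2)] a(2) unfolding r(3) by (auto simp: sgn_if split: if_splits)
  qed
qed

lemma cube_le_square: "K / (1 + \<bar>x\<bar>) ^ 3 \<le> K / (1 + \<bar>x\<bar>)\<^sup>2" if "K \<ge> 0" for K x :: real
  using that by (intro divide_left_mono power_increasing mult_pos_pos) auto

lemma row_summable:
  assumes z: "\<bar>Im z\<bar> \<le> Im \<tau> / 2"
  shows "(\<lambda>n. pcsc2 (z + of_int n * \<tau>)) summable_on UNIV"
    "(\<lambda>n. (pcsc2 (z + of_int n * \<tau>))\<^sup>2) summable_on UNIV"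
    "(\<lambda>n. pcot (z + of_int n * \<tau>) - (if n \<ge> 0 then - (of_real pi * \<i>) else of_real pi * \<i>)) summable_on UNIV"
proof -
  obtain K where K: "K > 0"
    "\<And>z n. \<bar>Im z\<bar> \<le> Im \<tau> / 2 \<Longrightarrow> n \<noteq> 0 \<Longrightarrow> norm (pcsc2 (z + of_int n * \<tau>)) \<le> K / (1 + \<bar>real_of_int n\<bar>) ^ 3"
    "\<And>z n. \<bar>Im z\<bar> \<le> Im \<tau> / 2 \<Longrightarrow> n \<noteq> 0 \<Longrightarrow>
      norm (pcot (z + of_int n * \<tau>) - (if n \<ge> 0 then - (of_real pi * \<i>) else of_real pi * \<i>))
        \<le> K / (1 + \<bar>real_of_int n\<bar>) ^ 3"
    by (rule row_bounds) blast
  show "(\<lambda>n. pcsc2 (z + of_int n * \<tau>)) summable_on UNIV"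
    using order_trans[OF K(2)[OF z] cube_le_square] K(1)
    by (intro summable_on_int_bound[where K = K]) auto
  show "(\<lambda>n. pcot (z + of_int n * \<tau>) - (if n \<ge> 0 then - (of_real pi * \<i>) else of_real pi * \<i>)) summable_on UNIV"
    using order_trans[OF K(3)[OF z] cube_le_square] K(1)
    by (intro summable_on_int_bound[where K = K]) auto
  show "(\<lambda>n. (pcsc2 (z + of_int n * \<tau>))\<^sup>2) summable_on UNIV"
  proof (rule summable_on_int_bound[where K = "K\<^sup>2"])
    fix n :: int assume n: "n \<noteq> 0"
    have 1: "(1 + \<bar>real_of_int n\<bar>) ^ 2 \<le> ((1 + \<bar>real_of_int n\<bar>) ^ 3)\<^sup>2"
      unfolding power_mult [symmetric] by (intro power_increasing) auto
    have "norm ((pcsc2 (z + of_int n * \<tau>))\<^sup>2) \<le> (K / (1 + \<bar>real_of_int n\<bar>) ^ 3)\<^sup>2"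
      unfolding norm_power using K(2)[OF z n] by (intro power_mono) auto
    also have "\<dots> \<le> K\<^sup>2 / (1 + \<bar>real_of_int n\<bar>)\<^sup>2"
      unfolding power_divide using 1 by (intro divide_left_mono mult_pos_pos) auto
    finally show "norm ((pcsc2 (z + of_int n * \<tau>))\<^sup>2) \<le> K\<^sup>2 / (1 + \<bar>real_of_int n\<bar>)\<^sup>2" .
  qed
qed

lemma dpcsc2_summable: "(\<lambda>k. of_int k * dpcsc2 (of_int k * \<tau>)) summable_on UNIV"
proof -
  obtain K where K: "K > 0"
    "\<And>z n. \<bar>Im z\<bar> \<le> Im \<tau> / 2 \<Longrightarrow> n \<noteq> 0 \<Longrightarrow> norm (pcsc2 (z + of_int n * \<tau>)) \<le> K / (1 + \<bar>real_of_int n\<bar>) ^ 3"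
    "\<And>z n. \<bar>Im z\<bar> \<le> Im \<tau> / 2 \<Longrightarrow> n \<noteq> 0 \<Longrightarrow> norm (pcot (z + of_int n * \<tau>)) \<le> K"
    by (rule row_bounds) blast
  show ?thesis
  proof (rule summable_on_int_bound[where K = "2 * K * K"])
    fix n :: int assume n: "n \<noteq> 0"
    have 0: "\<bar>Im 0\<bar> \<le> Im \<tau> / 2" using Im_pos by simp
    have "norm (of_int n * dpcsc2 (of_int n * \<tau>)) =
        2 * (\<bar>real_of_int n\<bar> * norm (pcot (of_int n * \<tau>)) * norm (pcsc2 (of_int n * \<tau>)))"
      by (simp add: dpcsc2_def norm_mult)
    also have "\<dots> \<le> 2 * ((1 + \<bar>real_of_int n\<bar>) * K * (K / (1 + \<bar>real_of_int n\<bar>) ^ 3))"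
      using K(2,3)[OF 0 n] K(1) by (intro mult_mono) auto
    also have "\<dots> = 2 * K * K / (1 + \<bar>real_of_int n\<bar>)\<^sup>2"
      by (simp add: divide_simps power2_eq_square power3_eq_cube)
    finally show "norm (of_int n * dpcsc2 (of_int n * \<tau>)) \<le> 2 * K * K / (1 + \<bar>real_of_int n\<bar>)\<^sup>2" .
  qed
qed

section \<open>Row sums, their quadratic relations and their half-period sums\<close>

definition rowP :: "complex \<Rightarrow> complex" where
  "rowP z = (\<Sum>\<^sub>\<infinity>n::int. pcsc2 (z + of_int n * \<tau>))"

definition rowB :: "complex \<Rightarrow> complex" where
  "rowB z = (\<Sum>\<^sub>\<infinity>n::int. (pcsc2 (z + of_int n * \<tau>))\<^sup>2)"

definition rowQ :: complex where
  "rowQ = (\<Sum>\<^sub>\<infinity>k::int. of_int k * dpcsc2 (of_int k * \<tau>))"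

lemma Im_0_le: "\<bar>Im 0\<bar> \<le> Im \<tau> / 2" using Im_pos by simp

lemma
  assumes z: "\<bar>Im z\<bar> \<le> Im \<tau> / 2"
  shows has_sum_rowP: "((\<lambda>n. pcsc2 (z + of_int n * \<tau>)) has_sum rowP z) UNIV"
    and has_sum_rowB: "((\<lambda>n. (pcsc2 (z + of_int n * \<tau>))\<^sup>2) has_sum rowB z) UNIV"
  unfolding rowP_def rowB_def using row_summable[OF z] by (auto intro: has_sum_infsum)

lemma has_sum_rowQ: "((\<lambda>k. of_int k * dpcsc2 (of_int k * \<tau>)) has_sum rowQ) UNIV"
  unfolding rowQ_def by (intro has_sum_infsum dpcsc2_summable)

lemma has_sum_pcsc2_expansion:
  assumes z: "\<bar>Im z\<bar> \<le> Im \<tau> / 2"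
  shows "((\<lambda>n. pcsc2 (of_int k * \<tau>) * (pcsc2 (z + of_int (n + k) * \<tau>) + pcsc2 (z + of_int n * \<tau>)) +
      dpcsc2 (of_int k * \<tau>) * (pcot (z + of_int n * \<tau>) - pcot (z + of_int (n + k) * \<tau>)))
    has_sum (2 * rowP z * pcsc2 (of_int k * \<tau>) +
      2 * of_real pi * \<i> * (of_int k * dpcsc2 (of_int k * \<tau>)))) UNIV"
proof -
  have t: "((\<lambda>n. pcot (z + of_int n * \<tau>) - pcot (z + of_int (n + k) * \<tau>)) has_sum
      (of_int k * (of_real pi * \<i> - - (of_real pi * \<i>)))) UNIV"
    by (rule has_sum_int_telescope row_summable(3) z)+
  have "((\<lambda>n. pcsc2 (of_int k * \<tau>) * (pcsc2 (z + of_int (n + k) * \<tau>) + pcsc2 (z + of_int n * \<tau>)) +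
      dpcsc2 (of_int k * \<tau>) * (pcot (z + of_int n * \<tau>) - pcot (z + of_int (n + k) * \<tau>)))
    has_sum (pcsc2 (of_int k * \<tau>) * (rowP z + rowP z) +
       dpcsc2 (of_int k * \<tau>) * (of_int k * (of_real pi * \<i> - - (of_real pi * \<i>))))) UNIV"
    by (intro has_sum_add has_sum_cmult_right t has_sum_rowP[OF z]
        has_sum_int_shift[OF has_sum_rowP[OF z]])
  thus ?thesis by (simp add: algebra_simps)
qed

text \<open>Sorted by index difference \<open>k\<close>: k = 0 gives \<open>rowB z\<close>, every
  other \<open>k\<close> falls under \<open>pcsc2_mult\<close>.\<close>

lemma rowP_square:
  assumes z: "\<bar>Im z\<bar> \<le> Im \<tau> / 2" and nl: "\<And>n. z + of_int n * \<tau> \<notin> \<int>"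
  shows "(rowP z)\<^sup>2 = rowB z + 2 * rowP z * rowP 0 + 2 * of_real pi * \<i> * rowQ"
proof -
  \<comment> \<open>At \<open>k = 0\<close> the first two summands vanish, by
    \<open>pcsc2 0 = 0\<close> and by the factor \<open>k\<close>; only \<open>rowB z\<close> is
    left.\<close>
  define h where "h k = 2 * rowP z * pcsc2 (0 + of_int k * \<tau>) +
      2 * of_real pi * \<i> * (of_int k * dpcsc2 (of_int k * \<tau>)) + (if k = 0 then rowB z else 0)" for k :: int
  have "((\<lambda>n. pcsc2 (z + of_int (n + k) * \<tau>) * pcsc2 (z + of_int n * \<tau>)) has_sum h k) UNIV" for k
  proof (cases "k = 0")
    case True
    thus ?thesis using has_sum_rowB[OF z] by (simp add: h_def power2_eq_square)
  next
    case False
    have d: "z + of_int (n + k) * \<tau> - (z + of_int n * \<tau>) = of_int k * \<tau>" for n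
      by (simp add: algebra_simps)
    have "pcsc2 (z + of_int (n + k) * \<tau>) * pcsc2 (z + of_int n * \<tau>) =
        pcsc2 (of_int k * \<tau>) * (pcsc2 (z + of_int (n + k) * \<tau>) + pcsc2 (z + of_int n * \<tau>)) +
        dpcsc2 (of_int k * \<tau>) * (pcot (z + of_int n * \<tau>) - pcot (z + of_int (n + k) * \<tau>))" for n
      using pcsc2_mult[OF nl nl, of "n + k" n] int_mult_not_Int[OF False] unfolding d by blast
    thus ?thesis using False has_sum_pcsc2_expansion[OF z, of k] by (simp add: h_def)
  qed
  hence "(h has_sum (rowP z)\<^sup>2) UNIV"
    by (rule has_sum_int_autocorrelation[OF has_sum_rowP[OF z]])
  moreover have "(h has_sum (2 * rowP z * rowP 0 + 2 * of_real pi * \<i> * rowQ + rowB z)) UNIV"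
    unfolding h_def
    by (intro has_sum_add has_sum_cmult_right has_sum_rowP Im_0_le has_sum_rowQ has_sum_single)
  ultimately show ?thesis using has_sum_unique by (metis add.commute add.assoc)
qed

text \<open>At z = 0 the product is 0 for n = 0 and n = -k although the expansion is not. Each of
  these two indices contributes a defect \<open>D k\<close>, and the sum of all defects is again
  expressed by \<open>rowB 0\<close> and \<open>rowP 0\<close>.\<close>

lemma rowP_zero_square:
  "0 = (rowP 0)\<^sup>2 + 4 * (of_real pi)\<^sup>2 * rowP 0 - 5 * rowB 0 + 2 * of_real pi * \<i> * rowQ"
proof -
  \<comment> \<open>The defect of the expansion at the two indices where one factor is the omitted pole.\<close>
  define D where "D k = 3 * (pcsc2 (0 + of_int k * \<tau>))\<^sup>2 - 2 * (of_real pi)\<^sup>2 * pcsc2 (0 + of_int k * \<tau>)" for k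
  define h where "h k = 2 * rowP 0 * pcsc2 (0 + of_int k * \<tau>) +
      2 * of_real pi * \<i> * (of_int k * dpcsc2 (of_int k * \<tau>)) - 2 * D k + (if k = 0 then rowB 0 else 0)" for k :: int
  have "((\<lambda>n. pcsc2 (0 + of_int (n + k) * \<tau>) * pcsc2 (0 + of_int n * \<tau>)) has_sum h k) UNIV" for k
  proof (cases "k = 0")
    case True
    thus ?thesis using has_sum_rowB[OF Im_0_le] by (simp add: h_def D_def power2_eq_square)
  next
    case False
    have d: "of_int (n + k) * \<tau> - of_int n * \<tau> = of_int k * \<tau>" for n
      by (simp add: algebra_simps)
    note kk = int_mult_not_Int[OF False]
    \<comment> \<open>The defect arises with a factor \<open>(pcot _)\<^sup>2\<close>; replacing it
      through \<open>pcsc2_eq_pcot\<close> leaves a polynomial in \<open>pcsc2\<close>, which can be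
      summed over \<open>k\<close>.\<close>
    have gen: "3 * c\<^sup>2 - 2 * r * c = c\<^sup>2 - (- 2 * p * c) * p" if "c = p\<^sup>2 + r" for c p r :: complex
      using that by algebra
    have Dk: "D k = (pcsc2 (of_int k * \<tau>))\<^sup>2 - dpcsc2 (of_int k * \<tau>) * pcot (of_int k * \<tau>)"
      using gen[OF pcsc2_eq_pcot[OF kk]] unfolding D_def dpcsc2_def by simp
    have "pcsc2 (0 + of_int (n + k) * \<tau>) * pcsc2 (0 + of_int n * \<tau>) =
        (pcsc2 (of_int k * \<tau>) * (pcsc2 (0 + of_int (n + k) * \<tau>) + pcsc2 (0 + of_int n * \<tau>)) +
        dpcsc2 (of_int k * \<tau>) * (pcot (0 + of_int n * \<tau>) - pcot (0 + of_int (n + k) * \<tau>)))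
        - ((if n = 0 then D k else 0) + (if n = - k then D k else 0))" for n
    proof -
      consider "n = 0" | "n = - k" | "n \<noteq> 0" "n + k \<noteq> 0" by linarith
      thus ?thesis
      proof cases
        case 1
        thus ?thesis using False by (simp add: Dk power2_eq_square algebra_simps)
      next
        case 2
        thus ?thesis using False pcsc2_minus[of "of_int k * \<tau>"] pcot_minus[of "of_int k * \<tau>"]
          by (simp add: Dk power2_eq_square algebra_simps)
      next
        case 3
        hence "n \<noteq> - k" by auto
        thus ?thesis 
          using 3 pcsc2_mult[OF int_mult_not_Int int_mult_not_Int, of "n + k" n] kk unfolding d by simp
      qed
    qed
    moreover have "((\<lambda>n. (pcsc2 (of_int k * \<tau>) * (pcsc2 (0 + of_int (n + k) * \<tau>) + pcsc2 (0 + of_int n * \<tau>)) +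
        dpcsc2 (of_int k * \<tau>) * (pcot (0 + of_int n * \<tau>) - pcot (0 + of_int (n + k) * \<tau>)))
        - ((if n = 0 then D k else 0) + (if n = - k then D k else 0))) has_sum h k) UNIV"
    proof -
      have "h k = 2 * rowP 0 * pcsc2 (of_int k * \<tau>) +
         2 * of_real pi * \<i> * (of_int k * dpcsc2 (of_int k * \<tau>)) - (D k + D k)"
        using False by (simp add: h_def)
      thus ?thesis
        by (simp only:) (intro has_sum_diff has_sum_add has_sum_single has_sum_pcsc2_expansion Im_0_le)
    qed
    ultimately show ?thesis by simp
  qed
  hence "(h has_sum (rowP 0)\<^sup>2) UNIV"
    by (rule has_sum_int_autocorrelation[OF has_sum_rowP[OF Im_0_le]])
  moreover have "(h has_sum (2 * rowP 0 * rowP 0 + 2 * of_real pi * \<i> * rowQ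
      - 2 * (3 * rowB 0 - 2 * (of_real pi)\<^sup>2 * rowP 0) + rowB 0)) UNIV"
    unfolding h_def D_def
    by (intro has_sum_add has_sum_diff has_sum_cmult_right has_sum_rowP has_sum_rowB Im_0_le has_sum_rowQ has_sum_single)
  ultimately have "(rowP 0)\<^sup>2 = 2 * rowP 0 * rowP 0 + 2 * of_real pi * \<i> * rowQ
      - 2 * (3 * rowB 0 - 2 * (of_real pi)\<^sup>2 * rowP 0) + rowB 0"
    using has_sum_unique by blast
  thus ?thesis by (simp add: algebra_simps power2_eq_square)
qed

text \<open>As u runs through n\<tau> and \<tau>/2 + n\<tau>, 2u runs through the even and the odd
  multiples of \<tau>. The duplication hypothesis fails to apply only at u = 0, which produces the
  correction in parentheses.\<close>

lemma half_shift_sum: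
  fixes G H :: "complex \<Rightarrow> complex"
  assumes GH: "\<And>u. 2 * u \<notin> \<int> \<Longrightarrow> G u + G (u + 1/2) = H (2 * u)"
    and G: "\<And>z. \<bar>Im z\<bar> \<le> Im \<tau> / 2 \<Longrightarrow> ((\<lambda>n. G (z + of_int n * \<tau>)) has_sum R z) UNIV"
    and H: "((\<lambda>n. H (of_int n * \<tau>)) has_sum s) UNIV"
  shows "R (1/2) + R (\<tau>/2) + R (1/2 + \<tau>/2) = s - R 0 + (G 0 + G (1/2) - H 0)"
proof -
  have im: "\<bar>Im (1/2)\<bar> \<le> Im \<tau> / 2" "\<bar>Im (\<tau>/2)\<bar> \<le> Im \<tau> / 2" "\<bar>Im (1/2 + \<tau>/2)\<bar> \<le> Im \<tau> / 2"
    using Im_pos by simp_all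
  have "((\<lambda>n. (G (0 + of_int n * \<tau>) + G (1/2 + of_int n * \<tau>)) - (if n = 0 then G 0 + G (1/2) - H 0 else 0))
      has_sum (R 0 + R (1/2) - (G 0 + G (1/2) - H 0))) UNIV"
    by (intro has_sum_add has_sum_diff G Im_0_le im has_sum_single)
  moreover have "(G (0 + of_int n * \<tau>) + G (1/2 + of_int n * \<tau>)) - (if n = 0 then G 0 + G (1/2) - H 0 else 0)
      = H (of_int (2 * n) * \<tau>)" for n
    using GH[of "of_int n * \<tau>"] int_mult_not_Int[of "2 * n"] by (auto simp: add.commute mult.assoc)
  ultimately have 1: "((\<lambda>n. H (of_int (2 * n) * \<tau>)) has_sum (R 0 + R (1/2) - (G 0 + G (1/2) - H 0))) UNIV"
    by simp
  have "((\<lambda>n. G (\<tau>/2 + of_int n * \<tau>) + G (1/2 + \<tau>/2 + of_int n * \<tau>))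
      has_sum (R (\<tau>/2) + R (1/2 + \<tau>/2))) UNIV"
    by (intro has_sum_add G im)
  moreover have "G (\<tau>/2 + of_int n * \<tau>) + G (1/2 + \<tau>/2 + of_int n * \<tau>) = H (of_int (2 * n + 1) * \<tau>)" for n
  proof -
    have e: "2 * (\<tau>/2 + of_int n * \<tau>) = of_int (2 * n + 1) * \<tau>" by (simp add: algebra_simps)
    have "2 * n + 1 \<noteq> 0" by presburger
    from GH[of "\<tau>/2 + of_int n * \<tau>", unfolded e, OF int_mult_not_Int[OF this]]
    show ?thesis by (simp add: add_ac)
  qed
  ultimately have 2: "((\<lambda>n. H (of_int (2 * n + 1) * \<tau>)) has_sum (R (\<tau>/2) + R (1/2 + \<tau>/2))) UNIV"
    by simp
  have "((\<lambda>n. H (of_int n * \<tau>)) has_sum (R 0 + R (1/2) - (G 0 + G (1/2) - H 0) + (R (\<tau>/2) + R (1/2 + \<tau>/2)))) UNIV"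
    by (rule has_sum_int_parity[OF 1 2])
  with H have "s = R 0 + R (1/2) - (G 0 + G (1/2) - H 0) + (R (\<tau>/2) + R (1/2 + \<tau>/2))"
    using has_sum_unique by blast
  thus ?thesis by (simp add: algebra_simps)
qed

lemma rowP_half_periods: "rowP (1/2) + rowP (\<tau>/2) + rowP (1/2 + \<tau>/2) = 3 * rowP 0 + (of_real pi)\<^sup>2"
proof -
  have "((\<lambda>n. 4 * pcsc2 (of_int n * \<tau>)) has_sum (4 * rowP 0)) UNIV"
    using has_sum_rowP[OF Im_0_le] by (intro has_sum_cmult_right) simp
  from half_shift_sum[where G = pcsc2 and R = rowP and H = "\<lambda>u. 4 * pcsc2 u", OF pcsc2_half_shift(1) has_sum_rowP this]
  show ?thesis by (simp add: pcsc2_half)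
qed

lemma rowB_half_periods: "rowB (1/2) + rowB (\<tau>/2) + rowB (1/2 + \<tau>/2) =
  15 * rowB 0 - 8 * (of_real pi)\<^sup>2 * rowP 0 + (of_real pi) ^ 4"
proof -
  have "((\<lambda>n. 16 * (pcsc2 (0 + of_int n * \<tau>))\<^sup>2 - 8 * (of_real pi)\<^sup>2 * pcsc2 (0 + of_int n * \<tau>))
      has_sum (16 * rowB 0 - 8 * (of_real pi)\<^sup>2 * rowP 0)) UNIV"
    by (intro has_sum_diff has_sum_cmult_right has_sum_rowP has_sum_rowB Im_0_le)
  hence "((\<lambda>n. 16 * (pcsc2 (of_int n * \<tau>))\<^sup>2 - 8 * (of_real pi)\<^sup>2 * pcsc2 (of_int n * \<tau>))
      has_sum (16 * rowB 0 - 8 * (of_real pi)\<^sup>2 * rowP 0)) UNIV" by simp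
  from half_shift_sum[where G = "\<lambda>u. (pcsc2 u)\<^sup>2" and R = rowB and H = "\<lambda>u. 16 * (pcsc2 u)\<^sup>2 - 8 * (of_real pi)\<^sup>2 * pcsc2 u", OF pcsc2_half_shift(2) has_sum_rowB this]
  show ?thesis by (simp add: pcsc2_half)
qed


section \<open>The Weierstrass functions as row sums\<close>

definition pt :: "int \<Rightarrow> int \<Rightarrow> complex" where
  "pt m n = of_int m * \<tau> + of_int n"

lemma pt_eq_iff: "pt m n = pt m' n' \<longleftrightarrow> m = m' \<and> n = n'"
proof
  assume e: "pt m n = pt m' n'"
  hence "real_of_int m * Im \<tau> = real_of_int m' * Im \<tau>"
    unfolding pt_def complex_eq_iff by simp
  hence "m = m'" using Im_pos by simp
  thus "m = m' \<and> n = n'" using e by (simp add: pt_def)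
qed auto

lemma pt_eq_0_iff: "pt m n = 0 \<longleftrightarrow> m = 0 \<and> n = 0"
  using pt_eq_iff[of m n 0 0] by (simp add: pt_def)

lemma tau_lattice_eq: "tau_lattice \<tau> = (\<lambda>(m, n). pt m n) ` (UNIV \<times> UNIV)"
proof -
  have "tau_lattice \<tau> = {of_int m + of_int n * \<tau> | m n :: int. True}"
    by (simp add: tau_lattice_def period_lattice_def omega1_def omega3_def)
  also have "\<dots> = (\<lambda>(m, n). pt m n) ` (UNIV \<times> UNIV)"
    by (auto simp: pt_def image_def) (metis add.commute)+
  finally show ?thesis .
qed

text \<open>Equivalence of norms in the real basis \<tau>, 1: the imaginary part controls x, then
  the triangle inequality controls y.\<close>

lemma norm_comparison:
  obtains c d where "c > 0" "d > 0"
    "\<And>x y :: real. c * (\<bar>x\<bar> + \<bar>y\<bar>) \<le> norm (of_real x * \<tau> + of_real y)"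
    "\<And>x y :: real. norm (of_real x * \<tau> + of_real y) \<le> d * (\<bar>x\<bar> + \<bar>y\<bar>)"
proof -
  define M where "M = 1 + (1 + norm \<tau>) / Im \<tau>"
  have M: "M > 0" using Im_pos by (simp add: M_def add_pos_nonneg)
  have 1: "\<bar>x\<bar> + \<bar>y\<bar> \<le> M * norm (of_real x * \<tau> + of_real y)" for x y :: real
  proof -
    define N where "N = norm (of_real x * \<tau> + of_real y)"
    have "\<bar>x\<bar> * Im \<tau> \<le> N"
      using abs_Im_le_cmod[of "of_real x * \<tau> + of_real y"] Im_pos by (simp add: N_def abs_mult)
    hence x: "\<bar>x\<bar> \<le> N / Im \<tau>" using Im_pos by (simp add: field_simps)
    have "\<bar>y\<bar> = norm ((of_real x * \<tau> + of_real y) - of_real x * \<tau>)" by simp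
    also have "\<dots> \<le> N + \<bar>x\<bar> * norm \<tau>"
      unfolding N_def by (rule order_trans[OF norm_triangle_ineq4]) (simp add: norm_mult)
    also have "\<dots> \<le> N + N / Im \<tau> * norm \<tau>" using x by (intro add_left_mono mult_right_mono) auto
    finally have "\<bar>x\<bar> + \<bar>y\<bar> \<le> N / Im \<tau> + (N + N / Im \<tau> * norm \<tau>)" using x by linarith
    also have "\<dots> = M * N" using Im_pos by (simp add: M_def field_simps)
    finally show ?thesis unfolding N_def .
  qed
  have 2: "norm (of_real x * \<tau> + of_real y) \<le> (norm \<tau> + 1) * (\<bar>x\<bar> + \<bar>y\<bar>)" for x y :: real
  proof -
    have "norm (of_real x * \<tau> + of_real y) \<le> norm \<tau> * \<bar>x\<bar> + 1 * \<bar>y\<bar>"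
      by (rule order_trans[OF norm_triangle_ineq]) (simp add: norm_mult mult.commute)
    also have "\<dots> \<le> (norm \<tau> + 1) * \<bar>x\<bar> + (norm \<tau> + 1) * \<bar>y\<bar>"
      by (intro add_mono mult_right_mono) auto
    finally show ?thesis by (simp add: distrib_left)
  qed
  show ?thesis
  proof (rule that[of "1 / M" "norm \<tau> + 1"])
    show "1 / M * (\<bar>x\<bar> + \<bar>y\<bar>) \<le> norm (of_real x * \<tau> + of_real y)" for x y :: real
      using 1[of x y] M by (simp add: field_simps)
  qed (use M 2 in \<open>auto intro: add_nonneg_pos\<close>)
qed

text \<open>
  For the summands of both Weierstrass functions, \<open>f 0\<close> is the isolated principal part \<open>1 / z\<^sup>2\<close> or
  \<open>1 / z\<close>, because \<open>1 / 0 = 0\<close>; the right-hand side is then the whole function.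
\<close>

lemma has_sum_lattice:
  fixes f :: "complex \<Rightarrow> complex"
  assumes bound: "\<And>w. w \<in> tau_lattice \<tau> \<Longrightarrow> w \<noteq> 0 \<Longrightarrow> norm (f w) \<le> K / norm w ^ 3"
  shows "((\<lambda>p. f (pt (fst p) (snd p))) has_sum (f 0 + (\<Sum>\<^sub>\<infinity>w\<in>tau_lattice \<tau> - {0}. f w))) (UNIV \<times> UNIV)"
proof -
  obtain c where c: "c > 0" "\<And>x y :: real. c * (\<bar>x\<bar> + \<bar>y\<bar>) \<le> norm (of_real x * \<tau> + of_real y)"
    by (rule norm_comparison) blast
  \<comment> \<open>With s = |m| + |n| \<ge> 1, (1 + |m|)(1 + |n|) \<le> (2s)^2. Raising to the
    power -3/2 bounds 1/(2s)^3 by a product of two summable weights.\<close>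
  define w :: "int \<Rightarrow> real" where "w m = (1 + \<bar>real_of_int m\<bar>) powr (- 3 / 2)" for m
  have w: "w summable_on UNIV" unfolding w_def by (rule summable_on_int_powr) simp
  have wpos: "w m > 0" for m by (simp add: w_def add_pos_nonneg)
  \<comment> \<open>The first entry covers the index (0, 0); the 8 comes from (2s)^3.\<close>
  define C where "C = max (norm (f 0)) (8 * \<bar>K\<bar> / c ^ 3)"
  have bd: "norm (f (pt (fst p) (snd p))) \<le> C * (w (fst p) * w (snd p))" for p
  proof (cases "p = (0, 0)")
    case True
    moreover have "w 0 = 1" "norm (f 0) \<le> C" by (simp_all add: w_def C_def)
    ultimately show ?thesis by (simp add: pt_def)
  next
    case False
    obtain m n where p: "p = (m, n)" by (cases p)
    define s where "s = \<bar>real_of_int m\<bar> + \<bar>real_of_int n\<bar>"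
    have mn: "m \<noteq> 0 \<or> n \<noteq> 0" using False p by auto
    hence s: "s \<ge> 1" unfolding s_def by linarith
    have nz: "pt m n \<noteq> 0" using mn pt_eq_0_iff by blast
    have "c * s \<le> norm (pt m n)"
      using c(2)[of "real_of_int m" "real_of_int n"] by (simp add: s_def pt_def)
    hence "(c * s) ^ 3 \<le> norm (pt m n) ^ 3" using c(1) s by (intro power_mono) auto
    hence a: "\<bar>K\<bar> / norm (pt m n) ^ 3 \<le> \<bar>K\<bar> / (c * s) ^ 3"
      using c(1) s nz by (intro divide_left_mono mult_pos_pos) auto
    have "(1 + \<bar>real_of_int m\<bar>) * (1 + \<bar>real_of_int n\<bar>) \<le> (2 * s) * (2 * s)"
      using s by (intro mult_mono) (auto simp: s_def)
    hence "(2 * s * (2 * s)) powr (- 3 / 2) \<le> ((1 + \<bar>real_of_int m\<bar>) * (1 + \<bar>real_of_int n\<bar>)) powr (- 3 / 2)"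
      by (intro powr_mono2') (auto intro: mult_pos_pos add_pos_nonneg)
    also have "\<dots> = w m * w n" by (simp add: w_def powr_mult)
    also have "(2 * s * (2 * s)) powr (- 3 / 2) = 1 / (2 * s) ^ 3"
    proof -
      have "(2 * s * (2 * s)) powr (- 3 / 2) = ((2 * s) powr 2) powr (- 3 / 2)"
        using s by (simp add: power2_eq_square)
      also have "\<dots> = (2 * s) powr (- 3)" unfolding powr_powr by simp
      also have "\<dots> = 1 / (2 * s) ^ 3" using s by (simp add: powr_minus_divide)
      finally show ?thesis .
    qed
    finally have b: "1 / (2 * s) ^ 3 \<le> w m * w n" .
    have "norm (f (pt m n)) \<le> K / norm (pt m n) ^ 3"
      using bound nz by (auto simp: tau_lattice_eq)
    also have "\<dots> \<le> \<bar>K\<bar> / norm (pt m n) ^ 3" by (intro divide_right_mono) auto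
    also note a
    also have "\<bar>K\<bar> / (c * s) ^ 3 = 8 * \<bar>K\<bar> / c ^ 3 * (1 / (2 * s) ^ 3)"
      by (simp add: power_mult_distrib)
    also have "\<dots> \<le> C * (w m * w n)"
      using b c(1) s by (intro mult_mono) (auto simp: C_def le_max_iff_disj)
    finally show ?thesis by (simp add: p)
  qed
  have "(\<lambda>p. w (fst p) * w (snd p)) summable_on (UNIV \<times> UNIV)"
    using wpos w
    by (intro summable_on_SigmaI[where g = "\<lambda>m. w m * infsum w UNIV"])
      (auto intro!: has_sum_cmult_right summable_on_cmult_left mult_nonneg_nonneg less_imp_le)
  hence "(\<lambda>p. C * (w (fst p) * w (snd p))) summable_on (UNIV \<times> UNIV)"
    by (rule summable_on_cmult_right)
  hence "(\<lambda>p. norm (f (pt (fst p) (snd p)))) summable_on (UNIV \<times> UNIV)"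
    by (rule summable_on_comparison_test) (use bd in auto)
  hence sm: "(\<lambda>p. f (pt (fst p) (snd p))) summable_on (UNIV \<times> UNIV)"
    by (rule abs_summable_summable)
  have inj: "inj_on (\<lambda>(m, n). pt m n) (UNIV \<times> UNIV)"
    by (auto simp: inj_on_def pt_eq_iff)
  have "f summable_on tau_lattice \<tau>"
    unfolding tau_lattice_eq using sm
    by (subst summable_on_reindex[OF inj]) (simp add: o_def case_prod_unfold)
  hence sm0: "f summable_on (tau_lattice \<tau> - {0})" by (rule summable_on_subset) (rule Diff_subset)
  have "0 = (\<lambda>(m, n). pt m n) (0, 0)" by (simp add: pt_def)
  hence z: "0 \<in> tau_lattice \<tau>" unfolding tau_lattice_eq by (rule image_eqI) simp
  have "(f has_sum (f 0 + (\<Sum>\<^sub>\<infinity>w\<in>tau_lattice \<tau> - {0}. f w))) (insert 0 (tau_lattice \<tau> - {0}))"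
    by (intro has_sum_insert has_sum_infsum sm0) auto
  hence "(f has_sum (f 0 + (\<Sum>\<^sub>\<infinity>w\<in>tau_lattice \<tau> - {0}. f w))) ((\<lambda>(m, n). pt m n) ` (UNIV \<times> UNIV))"
    using z by (simp add: insert_absorb tau_lattice_eq)
  thus ?thesis
    by (subst (asm) has_sum_reindex[OF inj]) (simp add: o_def case_prod_unfold)
qed

text \<open>On the row through the origin \<open>pcsc2\<close> takes its default value 0, and the
  constant supplies the true sum.\<close>

lemma row_inverse_squares:
  "((\<lambda>n. 1 / (pt m n)\<^sup>2) has_sum (pcsc2 (0 + of_int m * \<tau>) + (if m = 0 then (of_real pi)\<^sup>2 / 3 else 0))) UNIV"
proof (cases "m = 0")
  case True
  thus ?thesis using has_sum_inverse_squares_int by (simp add: pt_def)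
next
  case False
  thus ?thesis using pcsc2_has_sum[OF int_mult_not_Int[OF False]] by (simp add: pt_def)
qed

text \<open>A real number of modulus at most 1/2 is at distance at least |m|/2 from the integer m;
  \<open>norm_comparison\<close> carries this over to the lattice. It feeds the cubic bound of
  \<open>has_sum_lattice\<close>.\<close>

lemma half_cell_distance:
  assumes z: "z = of_real s * \<tau> + of_real t" and st: "\<bar>s\<bar> \<le> 1/2" "\<bar>t\<bar> \<le> 1/2"
  obtains c where "c > 0" "\<And>w. w \<in> tau_lattice \<tau> \<Longrightarrow> c * norm w \<le> norm (z - w)"
proof -
  obtain c d where cd: "c > 0" "d > 0"
    "\<And>x y :: real. c * (\<bar>x\<bar> + \<bar>y\<bar>) \<le> norm (of_real x * \<tau> + of_real y)"
    "\<And>x y :: real. norm (of_real x * \<tau> + of_real y) \<le> d * (\<bar>x\<bar> + \<bar>y\<bar>)"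
    by (rule norm_comparison) blast
  have half: "\<bar>real_of_int m\<bar> / 2 \<le> \<bar>r - real_of_int m\<bar>" if "\<bar>r\<bar> \<le> 1/2" for m r
  proof (cases "m = 0")
    case False
    hence "\<bar>real_of_int m\<bar> \<ge> 1" by linarith
    thus ?thesis using that by linarith
  qed simp
  show ?thesis
  proof (rule that[of "c / (2 * d)"])
    fix w assume "w \<in> tau_lattice \<tau>"
    then obtain m n where w: "w = pt m n" by (auto simp: tau_lattice_eq)
    have "c / (2 * d) * norm w \<le> c / (2 * d) * (d * (\<bar>real_of_int m\<bar> + \<bar>real_of_int n\<bar>))"
      using cd(1,2) cd(4)[of "real_of_int m" "real_of_int n"]
      by (intro mult_left_mono) (auto simp: w pt_def)
    also have "\<dots> = c * (\<bar>real_of_int m\<bar> / 2 + \<bar>real_of_int n\<bar> / 2)"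
      using cd(2) by (simp add: field_simps)
    also have "\<dots> \<le> c * (\<bar>s - real_of_int m\<bar> + \<bar>t - real_of_int n\<bar>)"
      using cd(1) half[OF st(1), of m] half[OF st(2), of n] by (intro mult_left_mono add_mono) auto
    also have "\<dots> \<le> norm (of_real (s - real_of_int m) * \<tau> + of_real (t - real_of_int n))"
      by (rule cd(3))
    also have "of_real (s - real_of_int m) * \<tau> + of_real (t - real_of_int n) = z - w"
      by (simp add: z w pt_def algebra_simps)
    finally show "c / (2 * d) * norm w \<le> norm (z - w)" .
  qed (use cd in auto)
qed

text \<open>The lattice sum is evaluated row by row with the partial fractions of
  \<open>pcsc2\<close>. The argument is - z because (z - w)^2 is rewritten as (-z + m\<tau> +
  n)^2.\<close>

lemma weierstrass_p_eq:
  assumes z: "z = of_real s * \<tau> + of_real t" and st: "\<bar>s\<bar> \<le> 1/2" "\<bar>t\<bar> \<le> 1/2"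
    and nl: "\<And>m. - z + of_int m * \<tau> \<notin> \<int>"
  shows "weierstrass_p (tau_lattice \<tau>) z = rowP (- z) - rowP 0 - (of_real pi)\<^sup>2 / 3"
proof -
  define f where "f w = 1 / (z - w)\<^sup>2 - 1 / w\<^sup>2" for w
  obtain c where c: "c > 0" "\<And>w. w \<in> tau_lattice \<tau> \<Longrightarrow> c * norm w \<le> norm (z - w)"
    using half_cell_distance[OF z st] by blast
  have "norm (f w) \<le> (norm z * (1 / c\<^sup>2 + 1 / c)) / norm w ^ 3" if "w \<in> tau_lattice \<tau>" "w \<noteq> 0" for w
  proof -
    have cw: "c * norm w \<le> norm (z - w)" "c * norm w > 0" using c that by auto
    hence nz: "z - w \<noteq> 0" by auto
    \<comment> \<open>Applied to v = z - w this extracts the factor v + w = z and leaves terms of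
      cubic decay.\<close>
    have "1 / v\<^sup>2 - 1 / w\<^sup>2 = (v + w) * (1 / (v\<^sup>2 * w) - 1 / (v * w\<^sup>2))" if "v \<noteq> 0" for v
      using that \<open>w \<noteq> 0\<close> by (simp add: field_simps power2_eq_square)
    from this[OF nz] have "f w = z * (1 / ((z - w)\<^sup>2 * w) - 1 / ((z - w) * w\<^sup>2))"
      unfolding f_def by simp
    hence "norm (f w) \<le> norm z * (1 / (norm (z - w) ^ 2 * norm w) + 1 / (norm (z - w) * norm w ^ 2))"
      using norm_triangle_ineq4[of "1 / ((z - w)\<^sup>2 * w)" "1 / ((z - w) * w\<^sup>2)"]
      by (simp add: norm_mult norm_divide norm_power mult_left_mono)
    also have "\<dots> \<le> norm z * (1 / ((c * norm w) ^ 2 * norm w) + 1 / (c * norm w * norm w ^ 2))"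
      using cw c(1) that nz
      by (intro mult_left_mono add_mono divide_left_mono mult_right_mono power_mono mult_pos_pos) auto
    also have "\<dots> = (norm z * (1 / c\<^sup>2 + 1 / c)) / norm w ^ 3"
      using c(1) that by (simp add: field_simps power2_eq_square power3_eq_cube)
    finally show ?thesis .
  qed
  note hs = has_sum_lattice[OF this]
  have wp: "weierstrass_p (tau_lattice \<tau>) z = f 0 + (\<Sum>\<^sub>\<infinity>w\<in>tau_lattice \<tau> - {0}. f w)"
    by (simp add: weierstrass_p_def f_def)
  define g where "g m = pcsc2 (- z + of_int m * \<tau>) -
      (pcsc2 (0 + of_int m * \<tau>) + (if m = 0 then (of_real pi)\<^sup>2 / 3 else 0))" for m
  have "((\<lambda>n. f (pt m n)) has_sum g m) UNIV" for m
  proof -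
    have "(z - pt m n)\<^sup>2 = (- z + of_int m * \<tau> + of_int n)\<^sup>2" for n
      by (simp add: pt_def power2_eq_square algebra_simps)
    thus ?thesis unfolding g_def f_def
      using has_sum_diff[OF pcsc2_has_sum[OF nl] row_inverse_squares] by simp
  qed
  hence "(g has_sum weierstrass_p (tau_lattice \<tau>) z) UNIV"
    unfolding wp using has_sum_SigmaD[OF hs, of g] by simp
  moreover have im: "\<bar>Im (- z)\<bar> \<le> Im \<tau> / 2"
    using z st Im_pos by (simp add: abs_mult mult_right_mono)
  have "(g has_sum (rowP (- z) - (rowP 0 + (of_real pi)\<^sup>2 / 3))) UNIV"
    unfolding g_def
    by (intro has_sum_diff has_sum_add has_sum_rowP im Im_0_le has_sum_single)
  ultimately show ?thesis using has_sum_unique by fastforce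
qed

text \<open>Identifies 2 eta1 with the weight 2 Eisenstein series summed by rows; it is not
  absolutely convergent, so the order matters. After pairing, each row of the zeta series yields the
  row sum of 1/w^2.\<close>

lemma eta1_eq: "2 * eta1 \<tau> = rowP 0 + (of_real pi)\<^sup>2 / 3"
proof -
  define f :: "complex \<Rightarrow> complex" where "f w = 1 / (1/2 - w) + 1 / w + 1/2 / w\<^sup>2" for w
  obtain c where c: "c > 0" "\<And>w. w \<in> tau_lattice \<tau> \<Longrightarrow> c * norm w \<le> norm (1/2 - w)"
    using half_cell_distance[of "1/2" 0 "1/2"] by auto
  have "norm (f w) \<le> (1 / (4 * c)) / norm w ^ 3" if "w \<in> tau_lattice \<tau>" "w \<noteq> 0" for w
  proof -
    have cw: "c * norm w \<le> norm (1/2 - w)" "c * norm w > 0" using c that by auto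
    hence "0 < norm (1/2 - w)" by linarith
    hence nz: "1/2 - w \<noteq> 0" by (metis norm_zero less_irrefl)
    \<comment> \<open>Since v + w = 1/2, the numerator over the common denominator is constant,
      which gives cubic decay.\<close>
    have "1 / v + 1 / w + 1/2 / w\<^sup>2 = 1 / (4 * (v * w\<^sup>2))" if "v = 1/2 - w" "v \<noteq> 0" for v
    proof -
      have "1 / v + 1 / w + 1/2 / w\<^sup>2 = (2 * w * (v + w) + v) / (2 * v * w\<^sup>2)"
        using that \<open>w \<noteq> 0\<close> by (simp add: field_simps power2_eq_square)
      also have "v + w = 1/2" using that by simp
      also have "2 * w * (1/2) + v = 1/2" using that by simp
      finally show ?thesis by simp
    qed
    from this[OF refl nz] have "norm (f w) = 1 / (4 * (norm (1/2 - w) * norm w ^ 2))"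
      unfolding f_def by (simp add: norm_divide norm_mult norm_power)
    also have "\<dots> \<le> 1 / (4 * (c * norm w * norm w ^ 2))"
      using cw c(1) that nz by (intro divide_left_mono mult_left_mono mult_right_mono mult_pos_pos) auto
    also have "\<dots> = (1 / (4 * c)) / norm w ^ 3" by (simp add: power2_eq_square power3_eq_cube)
    finally show ?thesis .
  qed
  note hs = has_sum_lattice[OF this]
  have ze: "eta1 \<tau> = f 0 + (\<Sum>\<^sub>\<infinity>w\<in>tau_lattice \<tau> - {0}. f w)"
    by (simp add: eta1_def weierstrass_zeta_def f_def omega1_def)
  have hs1: "((\<lambda>p. f (pt (fst p) (snd p))) has_sum eta1 \<tau>) (UNIV \<times> UNIV)"
    unfolding ze by (rule hs)
  \<comment> \<open>Adding the terms for \<open>w\<close> and \<open>1 - w\<close> cancels \<open>1 / (1/2 - w)\<close> and makes the rest telescope.\<close>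
  hence hs2: "((\<lambda>p. f (pt (- fst p) (1 - snd p))) has_sum eta1 \<tau>) (UNIV \<times> UNIV)"
    by (subst has_sum_reindex_bij_witness[of _ "\<lambda>(m, n). (- m, 1 - n)" "\<lambda>(m, n). (- m, 1 - n)"
        "UNIV \<times> UNIV" "\<lambda>p. f (pt (fst p) (snd p))" _ "eta1 \<tau>" "eta1 \<tau>"]) auto
  define h where "h m n = f (pt m n) + f (pt (- m) (1 - n))" for m n
  have hs3: "((\<lambda>(m, n). h m n) has_sum (eta1 \<tau> + eta1 \<tau>)) (UNIV \<times> UNIV)"
    using has_sum_add[OF hs1 hs2] by (simp add: h_def case_prod_unfold)
  define R where "R m = pcsc2 (0 + of_int m * \<tau>) + (if m = 0 then (of_real pi)\<^sup>2 / 3 else 0)" for m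
  have row: "((\<lambda>n. h m n) has_sum R m) UNIV" for m
  proof -
    define F where "F n = 1 / pt m n" for n
    have sq: "((\<lambda>n. (1 / (pt m n)\<^sup>2 + 1 / (pt m (n - 1))\<^sup>2) / 2) has_sum (R m + R m) / 2) UNIV"
      unfolding R_def
      using has_sum_int_shift[OF row_inverse_squares[of m], of "-1"]
      by (intro has_sum_divide_const has_sum_add row_inverse_squares) simp
    \<comment> \<open>Valid also at w = 0 and w = 1, where the convention 1/0 = 0 acts alike on both
      sides.\<close>
    have hF: "h m n = (F n - F (n - 1)) + (1 / (pt m n)\<^sup>2 + 1 / (pt m (n - 1))\<^sup>2) / 2" for n
    proof -
      define w where "w = pt m n"
      have e: "pt (- m) (1 - n) = 1 - w" "pt m (n - 1) = w - 1" by (simp_all add: w_def pt_def)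
      have "1/2 - (1 - w) = - (1/2 - w)" by (simp add: field_simps)
      hence "1 / (1/2 - (1 - w)) = - (1 / (1/2 - w))" by (simp only: minus_divide_right)
      moreover have "1 / (1 - w) = - (1 / (w - 1))"
        by (metis minus_diff_eq minus_divide_right)
      moreover have "(1 - w)\<^sup>2 = (w - 1)\<^sup>2" by (simp add: power2_commute)
      ultimately show ?thesis
        unfolding h_def F_def e w_def[symmetric] f_def by (simp add: add_divide_distrib mult.commute[of _ 2])
    qed
    have "(\<lambda>n. h m n) summable_on UNIV"
      using summable_on_SigmaD1[OF has_sum_imp_summable[OF hs3]] by simp
    hence "(\<lambda>n. h m n - (1 / (pt m n)\<^sup>2 + 1 / (pt m (n - 1))\<^sup>2) / 2) summable_on UNIV"
      by (intro has_sum_imp_summable[OF has_sum_diff[OF has_sum_infsum sq]])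
    hence "(\<lambda>n. F n - F (n - 1)) summable_on UNIV" by (simp add: hF)
    moreover have "(\<lambda>N. F (int N)) \<longlonglongrightarrow> 0"
      unfolding F_def pt_def using LIMSEQ_inverse_of_nat_shift by simp
    moreover have "(\<lambda>N. F (- int N)) \<longlonglongrightarrow> 0"
    proof -
      have "F (- int N) = - (1 / (- (of_int m * \<tau>) + of_nat N))" for N
        unfolding F_def pt_def by (simp add: minus_divide_right)
      thus ?thesis
        using tendsto_minus[OF LIMSEQ_inverse_of_nat_shift[of "- (of_int m * \<tau>)"]] by (simp only: minus_zero)
    qed
    ultimately have "((\<lambda>n. F n - F (n - 1)) has_sum 0) UNIV"
      by (rule has_sum_int_telescope_null)
    from has_sum_add[OF this sq] show ?thesis by (simp add: hF)
  qed
  have "(R has_sum (eta1 \<tau> + eta1 \<tau>)) UNIV"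
    using has_sum_SigmaD[OF hs3] row by simp
  moreover have "(R has_sum (rowP 0 + (of_real pi)\<^sup>2 / 3)) UNIV"
    unfolding R_def by (intro has_sum_add has_sum_rowP Im_0_le has_sum_single)
  ultimately show ?thesis using has_sum_unique by fastforce
qed

section \<open>Half-period values and the evaluation of \<open>rowQ\<close>\<close>

lemma rowP_minus:
  assumes z: "\<bar>Im z\<bar> \<le> Im \<tau> / 2"
  shows "rowP (- z) = rowP z"
proof -
  have "((\<lambda>n. pcsc2 (z + of_int (- n) * \<tau>)) has_sum rowP z) UNIV"
    by (rule has_sum_int_uminus[OF has_sum_rowP[OF z]])
  moreover have "pcsc2 (z + of_int (- n) * \<tau>) = pcsc2 (- z + of_int n * \<tau>)" for n
    using pcsc2_minus[of "z + of_int (- n) * \<tau>"] by (simp add: algebra_simps)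
  ultimately have "((\<lambda>n. pcsc2 (- z + of_int n * \<tau>)) has_sum rowP z) UNIV" by simp
  moreover have "((\<lambda>n. pcsc2 (- z + of_int n * \<tau>)) has_sum rowP (- z)) UNIV"
    using z by (intro has_sum_rowP) simp
  ultimately show ?thesis using has_sum_unique by blast
qed

lemma half_period_not_Int:
  "1/2 + of_int n * \<tau> \<notin> \<int>" "\<tau>/2 + of_int n * \<tau> \<notin> \<int>" "1/2 + \<tau>/2 + of_int n * \<tau> \<notin> \<int>"
proof -
  have *: "Im \<tau> / 2 + real_of_int n * Im \<tau> \<noteq> 0"
  proof
    assume "Im \<tau> / 2 + real_of_int n * Im \<tau> = 0"
    hence "(1 + 2 * real_of_int n) * Im \<tau> = 0" by (simp add: algebra_simps)
    hence "1 + 2 * real_of_int n = 0" using Im_pos by simp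
    hence "1 + 2 * n = 0" by linarith
    thus False by presburger
  qed
  show "\<tau>/2 + of_int n * \<tau> \<notin> \<int>" "1/2 + \<tau>/2 + of_int n * \<tau> \<notin> \<int>"
    using * by (auto simp: complex_is_Int_iff)
  show "1/2 + of_int n * \<tau> \<notin> \<int>"
  proof (cases "n = 0")
    case True
    thus ?thesis using fraction_not_in_Ints[of 2 1, where 'a = complex] by simp
  next
    case False
    thus ?thesis using Im_pos by (auto simp: complex_is_Int_iff)
  qed
qed

lemma e_eq:
  "e1 \<tau> = rowP (1/2) - 2 * eta1 \<tau>" "e3 \<tau> = rowP (\<tau>/2) - 2 * eta1 \<tau>"
  "e2 \<tau> = rowP (1/2 + \<tau>/2) - 2 * eta1 \<tau>"
proof -
  have neg: "- z + of_int m * \<tau> \<notin> \<int>" if "\<And>m. z + of_int m * \<tau> \<notin> \<int>" for z m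
  proof -
    have "z + of_int (- m) * \<tau> = - (- z + of_int m * \<tau>)" by simp
    thus ?thesis using that[of "- m"] Ints_minus[of "- z + of_int m * \<tau>"] by metis
  qed
  show "e1 \<tau> = rowP (1/2) - 2 * eta1 \<tau>"
    unfolding e1_def omega1_def eta1_eq
    using weierstrass_p_eq[of "1/2" 0 "1/2"] neg[OF half_period_not_Int(1)] rowP_minus[of "1/2"] Im_pos
    by simp
  show "e3 \<tau> = rowP (\<tau>/2) - 2 * eta1 \<tau>"
    unfolding e3_def omega3_def eta1_eq
    using weierstrass_p_eq[of "\<tau>/2" "1/2" 0] neg[OF half_period_not_Int(2)] rowP_minus[of "\<tau>/2"] Im_pos
    by simp
  \<comment> \<open>\<open>omega2\<close> is a negative half period, so - z is already 1/2 +
    \<tau>/2 and evenness is not invoked.\<close>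
  show "e2 \<tau> = rowP (1/2 + \<tau>/2) - 2 * eta1 \<tau>"
    unfolding e2_def omega1_def omega2_def omega3_def eta1_eq
    using weierstrass_p_eq[of "- (1/2) - \<tau>/2" "-1/2" "-1/2"] half_period_not_Int(3)
    by (simp add: add.commute[of "\<tau>/2"])
qed

lemma rowQ_eq: "of_real pi * \<i> * rowQ = 2 * (- (eta1 \<tau>)\<^sup>2 + g2 \<tau> / 48)"
proof -
  have im: "\<bar>Im (1/2)\<bar> \<le> Im \<tau> / 2" "\<bar>Im (\<tau>/2)\<bar> \<le> Im \<tau> / 2" "\<bar>Im (1/2 + \<tau>/2)\<bar> \<le> Im \<tau> / 2"
    using Im_pos by simp_all
  note sq = rowP_square[OF im(1) half_period_not_Int(1)] rowP_square[OF im(2) half_period_not_Int(2)]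
    rowP_square[OF im(3) half_period_not_Int(3)]
  define x y z a b q P A where "x = rowP (1/2)" and "y = rowP (\<tau>/2)" and "z = rowP (1/2 + \<tau>/2)"
    and "a = rowP 0" and "b = rowB 0" and "q = of_real pi * \<i> * rowQ" and "P = (of_real pi :: complex)\<^sup>2"
    and "A = eta1 \<tau>"
  note defs = x_def y_def z_def a_def b_def q_def P_def A_def
  have s1: "x + y + z = 3 * a + P" using rowP_half_periods by (simp add: defs)
  have A: "2 * A = a + P / 3" using eta1_eq by (simp add: defs)
  have "x\<^sup>2 + y\<^sup>2 + z\<^sup>2 = (rowB (1/2) + rowB (\<tau>/2) + rowB (1/2 + \<tau>/2)) + 2 * (x + y + z) * a + 6 * q"
    using sq by (simp add: defs algebra_simps)
  hence s2: "x\<^sup>2 + y\<^sup>2 + z\<^sup>2 = (15 * b - 8 * P * a + P\<^sup>2) + 2 * (3 * a + P) * a + 6 * q"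
    unfolding rowB_half_periods s1 by (simp add: defs)
  have s0: "a\<^sup>2 + 4 * P * a - 5 * b + 2 * q = 0"
    using rowP_zero_square by (simp add: defs algebra_simps)
  have g: "g2 \<tau> = - 4 * ((x - 2 * A) * (z - 2 * A) + (z - 2 * A) * (y - 2 * A) + (y - 2 * A) * (x - 2 * A))"
    by (simp add: g2_def e_eq defs)
  have P: "P = 6 * A - 3 * a" using A by (simp add: field_simps)
  \<comment> \<open>Eliminating \<open>b\<close> between \<open>s2\<close> and \<open>s0\<close>
    gives x^2 + y^2 + z^2 = (x + y + z)^2 + 12 q, where x + y + z = 6 A. As the e_i then sum to 0,
    g2 is twice the sum of their squares, that is 48 A^2 + 24 q.\<close>
  have "24 * q = - 48 * A\<^sup>2 + g2 \<tau>"
    unfolding g using s0 s1 s2 P by algebra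
  hence "24 * q = 24 * (2 * (- A\<^sup>2 + g2 \<tau> / 48))" by (simp add: algebra_simps)
  hence "q = 2 * (- A\<^sup>2 + g2 \<tau> / 48)" by (subst (asm) mult_cancel_left) simp
  thus ?thesis by (simp only: q_def A_def)
qed

section \<open>The derivative in \<open>\<tau>\<close>\<close>

text \<open>Termwise differentiation: for holomorphic terms a uniform majorant of the series near
  \<tau> suffices, and convergence of the derived series comes with it.\<close>

lemma has_field_derivative_rowP_0:
  "((\<lambda>t. \<Sum>\<^sub>\<infinity>n::int. pcsc2 (of_int n * t)) has_field_derivative rowQ) (at \<tau>)"
proof -
  \<comment> \<open>The ball of this radius stays in Im x \<ge> Im \<tau> / 2, so one constant
    serves all its points.\<close>
  define r where "r = Im \<tau> / 2"
  have r: "r > 0" using Im_pos by (simp add: r_def)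
  obtain K where K: "K > 0"
    "\<And>u x. 1 \<le> x \<Longrightarrow> x * r \<le> \<bar>Im u\<bar> \<Longrightarrow> norm (pcsc2 u) \<le> K / (1 + x) ^ 3"
    using pcsc2_pcot_cubic_decay[OF r] by metis
  define S where "S = ball \<tau> r"
  have S: "open S" "\<tau> \<in> S" using r by (simp_all add: S_def)
  have ImS: "r \<le> Im x" if "x \<in> S" for x
  proof -
    have "\<bar>Im (\<tau> - x)\<bar> < r"
      using that abs_Im_le_cmod[of "\<tau> - x"] by (simp add: S_def dist_norm)
    hence "\<bar>Im \<tau> - Im x\<bar> < r" by simp
    thus ?thesis unfolding r_def by linarith
  qed
  \<comment> \<open>Pairing the indices n and -n - 1 turns the sum over the integers into an
    ordinary series.\<close>
  define f where "f n x = pcsc2 (of_int (int n) * x) + pcsc2 (of_int (- int n - 1) * x)" for n x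
  define f' where "f' n x = of_int (int n) * dpcsc2 (of_int (int n) * x) +
    of_int (- int n - 1) * dpcsc2 (of_int (- int n - 1) * x)" for n x
  have der: "((\<lambda>x. pcsc2 (of_int k * x)) has_field_derivative of_int k * dpcsc2 (of_int k * x)) (at x)"
    if "x \<in> S" for k x
  proof (cases "k = 0")
    case False
    interpret x: upper_half x using ImS[OF that] r by unfold_locales simp
    show ?thesis
      using DERIV_chain2[OF pcsc2_has_field_derivative[OF x.int_mult_not_Int[OF False]] DERIV_cmult_Id]
      by (simp add: mult.commute)
  qed simp
  \<comment> \<open>Both indices have modulus at least n. The pair n = 0 is left out because the
    decay bound starts at 1.\<close>
  have bd: "norm (f n x) \<le> 2 * K * inverse (real (Suc n) ^ 3)" if "n \<ge> 1" "x \<in> S" for n x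
  proof -
    have n: "1 \<le> real n" "1 \<le> real n + 1" using that(1) by simp_all
    have le: "norm (pcsc2 (of_int k * x)) \<le> K / real (Suc n) ^ 3" if k: "real n \<le> \<bar>real_of_int k\<bar>" for k
    proof -
      have "real n * r \<le> \<bar>real_of_int k\<bar> * \<bar>Im x\<bar>"
        using k ImS[OF \<open>x \<in> S\<close>] r by (intro mult_mono) auto
      hence "real n * r \<le> \<bar>Im (of_int k * x)\<bar>" by (simp add: abs_mult)
      from K(2)[OF n(1) this] show ?thesis by simp
    qed
    have "norm (f n x) \<le> K / real (Suc n) ^ 3 + K / real (Suc n) ^ 3"
      unfolding f_def by (intro order_trans[OF norm_triangle_ineq] add_mono le) auto
    thus ?thesis by (simp add: divide_inverse)
  qed
  have "summable (\<lambda>n. inverse (real n ^ 3))" by (rule inverse_power_summable) simp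
  hence "summable (\<lambda>n. inverse (real (Suc n) ^ 3))"
    by (subst summable_Suc_iff[of "\<lambda>n. inverse (real n ^ 3)"])
  hence sm: "summable (\<lambda>n. 2 * K * inverse (real (Suc n) ^ 3))" by (rule summable_mult)
  obtain g g' where g: "\<forall>x\<in>S. (\<lambda>n. f n x) sums g x \<and> (\<lambda>n. f' n x) sums g' x \<and> (g has_field_derivative g' x) (at x)"
  proof (rule series_and_derivative_comparison[OF S(1) sm])
    show "(f n has_field_derivative f' n x) (at x)" if "x \<in> S" for n x
      unfolding f_def f'_def by (intro DERIV_add der that)
    show "\<forall>\<^sub>F n in sequentially. \<forall>x\<in>S. norm (f n x) \<le> 2 * K * inverse (real (Suc n) ^ 3)"
      using eventually_ge_at_top[of "1::nat"] by eventually_elim (use bd in blast)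
  qed blast
  have "g x = (\<Sum>\<^sub>\<infinity>n::int. pcsc2 (of_int n * x))" if "x \<in> S" for x
  proof -
    interpret x: upper_half x using ImS[OF that] r by unfold_locales simp
    have "((\<lambda>n. pcsc2 (of_int n * x)) has_sum (\<Sum>\<^sub>\<infinity>n::int. pcsc2 (of_int n * x))) UNIV"
      using x.row_summable(1)[OF x.Im_0_le] by (intro has_sum_infsum) simp
    from has_sum_int_imp_sums[OF this] have "(\<lambda>n. f n x) sums (\<Sum>\<^sub>\<infinity>n::int. pcsc2 (of_int n * x))"
      by (simp only: f_def)
    thus ?thesis using g that sums_unique2 by blast
  qed
  moreover have "g' \<tau> = rowQ"
    using has_sum_int_imp_sums[OF has_sum_rowQ] g S(2) sums_unique2 unfolding f'_def by blast
  ultimately show ?thesis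
    using has_field_derivative_transform_within_open[of g rowQ \<tau> S] g S by auto
qed

end

theorem propositionA3:
  fixes \<tau> :: complex
  assumes "Im \<tau> > 0"
  shows "(eta1 has_field_derivative
           (- (eta1 \<tau>)\<^sup>2 + g2 \<tau> / 48) / (complex_of_real pi * \<i>)) (at \<tau>)"
proof -
  interpret upper_half \<tau> using assms by unfold_locales
  \<comment> \<open>The locale fixes one modulus; \<open>F\<close> makes \<open>rowP 0\<close> a
    function of it.\<close>
  define F where "F t = (\<Sum>\<^sub>\<infinity>n::int. pcsc2 (of_int n * t))" for t
  \<comment> \<open>Needed on the whole half plane, since the derivative depends on a neighbourhood
    of \<tau>.\<close>
  have eta: "eta1 t = (F t + (of_real pi)\<^sup>2 / 3) / 2" if "Im t > 0" for t
  proof -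
    interpret t: upper_half t using that by unfold_locales
    show ?thesis using t.eta1_eq by (simp add: F_def t.rowP_def field_simps)
  qed
  have "((\<lambda>t. (F t + (of_real pi)\<^sup>2 / 3) / 2) has_field_derivative (rowQ + 0) / 2) (at \<tau>)"
    unfolding F_def by (intro DERIV_cdivide DERIV_add DERIV_const has_field_derivative_rowP_0)
  moreover have "(rowQ + 0) / 2 = (- (eta1 \<tau>)\<^sup>2 + g2 \<tau> / 48) / (complex_of_real pi * \<i>)"
    using rowQ_eq by (simp add: nonzero_eq_divide_eq mult_ac)
  ultimately have "((\<lambda>t. (F t + (of_real pi)\<^sup>2 / 3) / 2) has_field_derivative
      (- (eta1 \<tau>)\<^sup>2 + g2 \<tau> / 48) / (complex_of_real pi * \<i>)) (at \<tau>)" by (simp only:)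
  thus ?thesis
    by (rule has_field_derivative_transform_within_open[where S = "{t. Im t > 0}"])
      (use assms eta in \<open>auto simp: open_halfspace_Im_gt\<close>)
qed

end
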